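(* Let $l\ge1$, $n\ge1$, $l\le k\le n$ and $m\ge l+n$. Let $\mathcal{D}\subseteq\mathbb{F}_{q^m}^{l+n}$ be a maximum rank distance (MRD) code of dimension $k$ with systematic generator matrix $G=\begin{bmatrix} I & P\end{bmatrix}\in\mathbb{F}_{q^m}^{k\times(l+n)}$, and let $\mathcal{C}_1,\mathcal{C}_2,\psi$ be the nested coset coding scheme built from $\mathcal{D}$ and $G$ as described in the context. Let $(S,X)$ be random variables with an arbitrary joint distribution $P_{S,X}$ such that $S\in\mathbb{F}_{q^m}^l$ and $X\in\psi(S)$. Then for $0\le\mu\le\dim\mathcal{C}_1=k$ the universal equivocation $\Theta_{\mu,P_{S,X}}=\min_{B\in\mathbb{F}_q^{\mu\times n}}H(S|BX^{\rm T})$ satisfies $$H(S)-D(X\|U_{\psi(S)}|S)-[\mu-\dim\mathcal{C}_2]^+\ \le\ \Theta_{\mu,P_{S,X}}\ \le\ l-[\mu-\dim\mathcal{C}_2]^+ .$$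
   Context: $\mathbb{F}_{q^m}$ is the degree-$m$ extension of the finite field $\mathbb{F}_q$; linear codes are $\mathbb{F}_{q^m}$-subspaces, dimensions are over $\mathbb{F}_{q^m}$. For $x,y\in\mathbb{F}_{q^m}^N$ the rank distance $d_R(x,y)$ is the $\mathbb{F}_q$-dimension of the $\mathbb{F}_q$-span in $\mathbb{F}_{q^m}$ of the coordinates of $y-x$; $d_R(\mathcal{C})$ is the minimum of $d_R(x,0)$ over nonzero $x\in\mathcal{C}$. A linear code $\mathcal{C}\subseteq\mathbb{F}_{q^m}^N$ is MRD if $d_R(\mathcal{C})=\min\{1,m/N\}(N-\dim\mathcal{C})+1$ (so $=N-\dim\mathcal{C}+1$ when $m\ge N$). $[x]^+=\max\{0,x\}$. Construction: write $$G=\begin{bmatrix} I & \Delta G\\ O & G_2\end{bmatrix},$$ with $I$ the $l\times l$ identity, $\Delta G\in\mathbb{F}_{q^m}^{l\times n}$, $G_2\in\mathbb{F}_{q^m}^{(k-l)\times n}$. Let $\mathcal{C}_1\subseteq\mathbb{F}_{q^m}^n$ be the punctured code consisting of the last $n$ coordinates of all codewords of $\mathcal{D}$ (generated by the rows of $\Delta G$ and $G_2$), and $\mathcal{C}_2\subseteq\mathcal{C}_1$ the shortened code consisting of the last $n$ coordinates of those codewords of $\mathcal{D}$ whose first $l$ coordinates are zero (generated by the rows of $G_2$). Then $\dim\mathcal{C}_1=k$, $\dim\mathcal{C}_2=k-l$, and $\psi:\mathbb{F}_{q^m}^l\to\mathcal{C}_1/\mathcal{C}_2$, $\psi(S)=S\Delta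 G+\mathcal{C}_2$, is a linear bijection. Entropies $H$ and relative entropies $D$ use logarithms to base $q^m$; $D(X\|U_{\psi(S)}|S)=\sum_s P_S(s)\,D(P_{X|S=s}\,\|\,\text{uniform distribution on }\psi(s))$. *)

theory Defs
  imports
    "HOL-Probability.Probability"
    "HOL-Algebra.Embedded_Algebras"
    "Jordan_Normal_Form.VS_Connect"
begin

text \<open>
  The field \<open>F\<^bsub>q^m\<^esub>\<close> is a finite field type \<open>'a\<close>, viewed through \<^const>\<open>class_ring\<close> as a
  ring record whose carrier is the whole type; \<open>F\<^sub>q\<close> is a subfield \<open>K\<close> of it, given as a set.
  Dimensions over \<open>K\<close> are those of \<^const>\<open>ring.dim\<close>, dimensions over \<open>'a\<close> those of
  \<^const>\<open>vectorspace.dim\<close>.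
\<close>

definition linear_code :: "nat \<Rightarrow> 'a::field vec set \<Rightarrow> bool" where
  "linear_code N C \<longleftrightarrow> VectorSpace.subspace class_ring C (module_vec TYPE('a) N)"

definition code_dim :: "nat \<Rightarrow> 'a::field vec set \<Rightarrow> nat" where
  "code_dim N C = vectorspace.dim (class_ring :: 'a ring) ((module_vec TYPE('a) N)\<lparr>carrier := C\<rparr>)"

definition rank_distance :: "'a::field set \<Rightarrow> 'a vec \<Rightarrow> 'a vec \<Rightarrow> nat" where
  "rank_distance K x y =
     ring.dim class_ring K (ring.Span class_ring K (list_of_vec (y - x)))"

definition min_rank_distance :: "'a::field set \<Rightarrow> nat \<Rightarrow> 'a vec set \<Rightarrow> nat" where
  "min_rank_distance K N C = Min {rank_distance K x (0\<^sub>v N) | x. x \<in> C \<and> x \<noteq> 0\<^sub>v N}"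

definition ext_degree :: "'a::field set \<Rightarrow> nat" where
  "ext_degree K = ring.dim (class_ring :: 'a ring) K UNIV"

definition MRD :: "'a::field set \<Rightarrow> nat \<Rightarrow> 'a vec set \<Rightarrow> bool" where
  "MRD K N C \<longleftrightarrow> linear_code N C \<and>
     real (min_rank_distance K N C) =
       min 1 (real (ext_degree K) / real N) * (real N - real (code_dim N C)) + 1"

text \<open>The second block row of the four-block matrix below has no rows.\<close>

definition systematic_generator :: "nat \<Rightarrow> nat \<Rightarrow> 'a::field mat \<Rightarrow> 'a vec set \<Rightarrow> bool" where
  "systematic_generator k N G C \<longleftrightarrow>
     (\<exists>P \<in> carrier_mat k (N - k). G = four_block_mat (1\<^sub>m k) P (0\<^sub>m 0 k) (0\<^sub>m 0 (N - k))) \<and>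
     vec_space.row_space N G = C"

definition punctured_code :: "nat \<Rightarrow> 'a vec set \<Rightarrow> 'a vec set" where
  "punctured_code n C = (\<lambda>v. vec_last v n) ` C"

definition shortened_code :: "nat \<Rightarrow> nat \<Rightarrow> 'a::zero vec set \<Rightarrow> 'a vec set" where
  "shortened_code l n C = (\<lambda>v. vec_last v n) ` {v \<in> C. vec_first v l = 0\<^sub>v l}"

text \<open>The coset \<open>s \<Delta>G + C\<^sub>2\<close>; the row vector times matrix product is written with the transpose.\<close>

definition coset_map :: "'a::field mat \<Rightarrow> 'a vec set \<Rightarrow> 'a vec \<Rightarrow> 'a vec set" where
  "coset_map \<Delta>G C\<^sub>2 s = (\<lambda>c. \<Delta>G\<^sup>T *\<^sub>v s + c) ` C\<^sub>2"

definition uniform_on :: "nat \<Rightarrow> 'a vec set \<Rightarrow> 'a vec measure" where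
  "uniform_on n A = uniform_measure (count_space (carrier_vec n)) A"

context prob_space
begin

text \<open>
  \<open>D(X \<parallel> Q\<^bsub>S\<^esub> | S)\<close>: the conditional law of \<open>X\<close> given \<open>S = s\<close> is compared with \<open>Q s\<close>.
  \<^term>\<open>KL_divergence b M N\<close> is \<open>D(N \<parallel> M)\<close>, so the reference measure comes first.
\<close>

definition conditional_divergence ::
    "real \<Rightarrow> ('a \<Rightarrow> 's) \<Rightarrow> ('a \<Rightarrow> 'x) \<Rightarrow> ('s \<Rightarrow> 'x measure) \<Rightarrow> real" where
  "conditional_divergence b S X Q =
     (\<Sum>s \<in> S ` space M. prob (S -` {s} \<inter> space M) *
        KL_divergence b (Q s) (distr (uniform_measure M (S -` {s} \<inter> space M)) (Q s) X))"

definition discrete_entropy :: "real \<Rightarrow> ('a \<Rightarrow> 's) \<Rightarrow> real" where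
  "discrete_entropy b S = entropy b (count_space (S ` space M)) S"

definition discrete_cond_entropy :: "real \<Rightarrow> ('a \<Rightarrow> 's) \<Rightarrow> ('a \<Rightarrow> 'y) \<Rightarrow> real" where
  "discrete_cond_entropy b S Y =
     conditional_entropy b (count_space (S ` space M)) (count_space (Y ` space M)) S Y"

definition universal_equivocation ::
    "real \<Rightarrow> 'f::field set \<Rightarrow> nat \<Rightarrow> nat \<Rightarrow> ('a \<Rightarrow> 'f vec) \<Rightarrow> ('a \<Rightarrow> 'f vec) \<Rightarrow> real" where
  "universal_equivocation b K \<mu> n S X =
     Min ((\<lambda>B. discrete_cond_entropy b S (\<lambda>\<omega>. B *\<^sub>v X \<omega>)) `
            {B \<in> carrier_mat \<mu> n. elements_mat B \<subseteq> K})"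

end

end

theory Submission
  imports Defs
begin

text \<open>
  Write \<open>Q = q\<^sup>m\<close>; every dimension is read off as the exponent of a cardinality. The coordinates of a
  vector \<open>x\<close> of rank \<open>r\<close> satisfy \<open>q\<^bsup>N - r\<^esup>\<close> linear relations over the small field, and a nonzero \<open>x \<in> \<D>\<close>
  has rank at least \<open>l + n - k + 1\<close>, hence fewer than \<open>q\<^sup>k\<close> relations. If \<open>r\<close> independent linear forms over
  the small field vanish on \<open>y\<close>, they contribute \<open>q\<^sup>r\<close> relations to \<open>(s, y)\<close>, and \<open>q\<^bsup>l + r\<^esup>\<close> if \<open>s = 0\<close>. So any \<open>k\<close>
  such forms are injective on \<open>C\<^sub>1\<close> and any \<open>k - l\<close> of them are injective, thus bijective, on \<open>C\<^sub>2\<close>.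

  Consequently \<open>dim (B C\<^sub>1) - dim (B C\<^sub>2) \<le> max 0 (\<mu> - dim C\<^sub>2)\<close> for every \<open>B\<close>, and a single application of
  \<open>ln t \<le> t - 1\<close> to the joint law of \<open>(S, X)\<close> gives
  \<open>H(S|BX) \<ge> H(S) - D - (dim (B C\<^sub>1) - dim (B C\<^sub>2))\<close>. For the upper bound take for \<open>B\<close> any \<open>\<mu>\<close> of \<open>k\<close> independent
  forms: all its fibres on \<open>C\<^sub>1\<close> have at most \<open>Q\<^bsup>k - \<mu>\<^esup>\<close> elements, so at most that many values of \<open>S\<close> are compatible
  with a given observation.
\<close>

unbundle no inner_syntax

subsection \<open>Counting vectors and codewords\<close>

lemma
  fixes x y :: "'a::ab_group_add vec"
  assumes "x \<in> carrier_vec n" "y \<in> carrier_vec n"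
  shows add_vec_diff_cancel: "x + y - x = y" and add_vec_diff: "x + (y - x) = y"
  using assms by (auto intro!: eq_vecI)

lemma scalar_prod_diff_eq_0_iff:
  fixes v :: "'a::field vec"
  assumes "v \<in> carrier_vec n" "x \<in> carrier_vec n" "y \<in> carrier_vec n"
  shows "v \<bullet> (x - y) = 0 \<longleftrightarrow> v \<bullet> x = v \<bullet> y"
  using scalar_prod_minus_distrib[OF assms] by simp

lemma minus_vec_eq_0_iff:
  fixes x :: "'a::field vec"
  assumes "x \<in> carrier_vec n" "y \<in> carrier_vec n"
  shows "x - y = 0\<^sub>v n \<longleftrightarrow> x = y"
proof
  assume "x - y = 0\<^sub>v n"
  then have "(x - y) $ i = 0" if "i < n" for i using that by simp
  then show "x = y" using assms by (intro eq_vecI) auto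
qed (use assms in auto)

text \<open>On \<open>A\<close> the map \<open>g\<close> factors through \<open>f\<close>: any
  choice of preimages such as \<open>inv_into A f\<close> recovers the value of
  \<open>g\<close>.\<close>

lemma card_image_le_card_image:
  assumes "finite A" and "\<And>x y. x \<in> A \<Longrightarrow> y \<in> A \<Longrightarrow> f x = f y \<Longrightarrow> g x = g y"
  shows "card (g ` A) \<le> card (f ` A)"
proof -
  have "g x = g (inv_into A f (f x))" if "x \<in> A" for x
    using that by (intro assms(2)) (auto simp: inv_into_into f_inv_into_f)
  then have "g ` A = (\<lambda>z. g (inv_into A f z)) ` f ` A" by (auto simp: image_iff)
  then show ?thesis using card_image_le[of "f ` A"] assms(1) by simp
qed

text \<open>Counting form of the isomorphism theorem: every nonempty fibre of \<open>f\<close> is a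
  translate of the kernel \<open>N\<close>. Linearity enters through \<open>add\<close> and
  \<open>fibre\<close> alone, so the same statement serves spaces over the small field and codes
  over the large one.\<close>

lemma card_kernel_image:
  fixes C :: "'a::field vec set"
  assumes "finite C" and "C \<subseteq> carrier_vec n" and "N \<subseteq> C"
    and add: "\<And>x y. x \<in> C \<Longrightarrow> y \<in> N \<Longrightarrow> x + y \<in> C"
    and fibre: "\<And>x y. x \<in> C \<Longrightarrow> y \<in> C \<Longrightarrow> f x = f y \<longleftrightarrow> x - y \<in> N"
  shows "card C = card (f ` C) * card N"
proof -
  have "card {x \<in> C. f x = z} = card N" if "z \<in> f ` C" for z
  proof -
    obtain x0 where x0: "x0 \<in> C" "z = f x0" using \<open>z \<in> f ` C\<close> by auto
    have "x \<in> (+) x0 ` N" if "x \<in> C" "f x = f x0" for x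
    proof
      show "x - x0 \<in> N" using fibre that x0 by blast
      have "x \<in> carrier_vec n" "x0 \<in> carrier_vec n" using that x0 assms by auto
      then show "x = x0 + (x - x0)" by auto
    qed
    moreover have "x0 + y \<in> C \<and> f (x0 + y) = f x0" if "y \<in> N" for y
    proof -
      have "x0 \<in> carrier_vec n" "y \<in> carrier_vec n" using that x0 assms by auto
      then have "x0 + y - x0 = y" by auto
      then show ?thesis using fibre[of "x0 + y" x0] add that x0 by simp
    qed
    ultimately have "{x \<in> C. f x = z} = (+) x0 ` N" unfolding x0(2) by auto
    moreover have "inj_on ((+) x0) N"
    proof (rule inj_onI)
      fix u v assume "u \<in> N" "v \<in> N" "x0 + u = x0 + v"
      have "x0 \<in> carrier_vec n" "u \<in> carrier_vec n" "v \<in> carrier_vec n"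
        using x0 \<open>u \<in> N\<close> \<open>v \<in> N\<close> assms by auto
      then have "x0 + u - x0 = u" "x0 + v - x0 = v" by auto
      then show "u = v" using \<open>x0 + u = x0 + v\<close> by metis
    qed
    ultimately show ?thesis by (simp add: card_image)
  qed
  moreover have "card C = (\<Sum>z\<in>f ` C. card {x \<in> C. f x = z})"
    using sum.image_gen[OF \<open>finite C\<close>, of "\<lambda>_. 1 :: nat" f] by simp
  ultimately show ?thesis by simp
qed

section \<open>Vectors with entries in a given set\<close>

definition vecs_over :: "'a set \<Rightarrow> nat \<Rightarrow> 'a vec set" where
  "vecs_over K n = {v \<in> carrier_vec n. \<forall>i<n. v $ i \<in> K}"

lemma vecs_over_UNIV: "vecs_over UNIV n = carrier_vec n"
  by (simp add: vecs_over_def)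

lemma
  assumes "finite K"
  shows finite_vecs_over: "finite (vecs_over K n)"
    and card_vecs_over: "card (vecs_over K n) = card K ^ n"
proof -
  have img: "vecs_over K n = vec n ` ({..<n} \<rightarrow>\<^sub>E K)"
  proof (intro equalityI subsetI)
    fix v assume "v \<in> vecs_over K n"
    then have "v = vec n (restrict (($) v) {..<n})" "restrict (($) v) {..<n} \<in> {..<n} \<rightarrow>\<^sub>E K"
      by (auto simp: vecs_over_def)
    then show "v \<in> vec n ` ({..<n} \<rightarrow>\<^sub>E K)" by blast
  next
    fix v assume "v \<in> vec n ` ({..<n} \<rightarrow>\<^sub>E K)"
    then obtain f where "f \<in> {..<n} \<rightarrow>\<^sub>E K" "v = vec n f" by blast
    then show "v \<in> vecs_over K n" by (auto simp: vecs_over_def dest: PiE_mem)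
  qed
  have "inj_on (vec n) ({..<n} \<rightarrow>\<^sub>E K)"
  proof (rule inj_onI)
    fix f g :: "nat \<Rightarrow> 'a" assume fg: "f \<in> {..<n} \<rightarrow>\<^sub>E K" "g \<in> {..<n} \<rightarrow>\<^sub>E K" "vec n f = vec n g"
    have "f i = g i" if "i < n" for i using arg_cong[OF fg(3), of "\<lambda>v. v $ i"] that by simp
    then show "f = g" using fg by (intro PiE_ext) auto
  qed
  then show "card (vecs_over K n) = card K ^ n"
    unfolding img by (simp add: card_image card_PiE)
  show "finite (vecs_over K n)" unfolding img using assms by (intro finite_imageI finite_PiE) auto
qed

lemma finite_carrier_vec: "finite (carrier_vec n :: 'a::finite vec set)"
  using finite_vecs_over[of "UNIV :: 'a set" n] by (simp add: vecs_over_UNIV)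

lemma card_carrier_vec: "card (carrier_vec n :: 'a::finite vec set) = CARD('a) ^ n"
  using card_vecs_over[of "UNIV :: 'a set" n] by (simp add: vecs_over_UNIV)

lemma finite_carrier_mat: "finite (carrier_mat nr nc :: 'a::finite mat set)"
proof (rule finite_subset)
  show "carrier_mat nr nc \<subseteq> mat_of_rows nc ` {rs. set rs \<subseteq> (carrier_vec nc :: 'a vec set) \<and> length rs = nr}"
  proof
    fix A :: "'a mat" assume A: "A \<in> carrier_mat nr nc"
    then have "A = mat_of_rows nc (rows A)" "set (rows A) \<subseteq> carrier_vec nc" "length (rows A) = nr"
      using mat_of_rows_rows[of A] rows_carrier[of A] by auto
    then show "A \<in> mat_of_rows nc ` {rs. set rs \<subseteq> carrier_vec nc \<and> length rs = nr}" by blast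
  qed
  show "finite (mat_of_rows nc ` {rs. set rs \<subseteq> (carrier_vec nc :: 'a vec set) \<and> length rs = nr})"
    by (intro finite_imageI finite_lists_length_eq finite_carrier_vec)
qed

section \<open>Linear codes and their cardinalities\<close>

lemma linear_codeI:
  fixes C :: "'a::field vec set"
  assumes "C \<subseteq> carrier_vec n" and "0\<^sub>v n \<in> C"
    and "\<And>x y. x \<in> C \<Longrightarrow> y \<in> C \<Longrightarrow> x + y \<in> C" and "\<And>c x. x \<in> C \<Longrightarrow> c \<cdot>\<^sub>v x \<in> C"
  shows "linear_code n C"
  unfolding linear_code_def subspace_def submodule_def
  using assms vec_vs[of n, where 'a='a] vec_module[of n, where 'a='a] by (simp add: module_vec_simps)

lemma linear_codeD:
  fixes C :: "'a::field vec set"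
  assumes "linear_code n C"
  shows linear_code_carrier: "C \<subseteq> carrier_vec n"
    and linear_code_zero: "0\<^sub>v n \<in> C"
    and linear_code_add: "\<And>x y. x \<in> C \<Longrightarrow> y \<in> C \<Longrightarrow> x + y \<in> C"
    and linear_code_smult: "\<And>c x. x \<in> C \<Longrightarrow> c \<cdot>\<^sub>v x \<in> C"
  using assms unfolding linear_code_def subspace_def submodule_def by (auto simp: module_vec_simps)

lemma linear_code_diff:
  fixes C :: "'a::field vec set"
  assumes "linear_code n C" and "x \<in> C" and "y \<in> C"
  shows "x - y \<in> C"
proof -
  have "x \<in> carrier_vec n" "y \<in> carrier_vec n" using linear_code_carrier assms by auto
  then have "x - y = x + (- 1) \<cdot>\<^sub>v y" by (intro eq_vecI) auto
  then show ?thesis using assms by (simp add: linear_code_add linear_code_smult)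
qed

text \<open>Coordinates with respect to a basis biject the code with the functions from that basis
  to the field. This makes \<open>code_dim\<close> an exponent and lets all later arguments
  count.\<close>

lemma card_linear_code:
  fixes C :: "'a::{field,finite} vec set"
  assumes "linear_code n C"
  shows "card C = CARD('a) ^ code_dim n C"
proof -
  let ?V = "(module_vec TYPE('a) n)\<lparr>carrier := C\<rparr>"
  interpret V: vectorspace "class_ring :: 'a ring" "module_vec TYPE('a) n" by (rule vec_vs)
  interpret W: vectorspace "class_ring :: 'a ring" ?V
    using assms unfolding linear_code_def by (rule V.subspace_is_vs)
  have C: "carrier ?V = C" by simp
  have fin: "finite C" using finite_subset[OF linear_code_carrier[OF assms] finite_carrier_vec] .
  \<comment> \<open>A finite code is spanned by the finite set of all its words, so a finite basis
    exists.\<close>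
  have "W.fin_dim"
    unfolding W.fin_dim_def
  proof (intro exI conjI)
    show "finite C" "C \<subseteq> carrier ?V" using fin by auto
    show "W.span C = carrier ?V"
      using W.in_own_span[of C] W.span_is_subset2[of C] by auto
  qed
  then obtain A where A: "finite A" "W.basis A" using W.finite_basis_exists by blast
  then have AC: "A \<subseteq> carrier ?V" unfolding W.basis_def by auto
  have "bij_betw (\<lambda>a. W.lincomb a A) (A \<rightarrow>\<^sub>E (UNIV :: 'a set)) C"
  proof -
    have ex1: "\<exists>!a. a \<in> A \<rightarrow>\<^sub>E (UNIV :: 'a set) \<and> W.lincomb a A = v" if "v \<in> C" for v
      using W.basis_criterion[OF A(1) AC] A(2) that by (simp add: class_ring_simps)
    have "W.lincomb a A \<in> C" for a :: "'a vec \<Rightarrow> 'a"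
      using W.lincomb_closed[OF AC, of a] by (auto simp: class_ring_simps)
    then show ?thesis using ex1 by (intro bij_betwI') (blast+)
  qed
  from bij_betw_same_card[OF this] have "card C = card (A \<rightarrow>\<^sub>E (UNIV :: 'a set))" by simp
  then show ?thesis
    using W.dim_basis[OF A] A(1) unfolding code_dim_def by (simp add: card_PiE)
qed

subsection \<open>Rank distance and linear relations over the subfield\<close>

text \<open>Induction along \<open>ring.dimension\<close>: a line extension by some \<open>v\<close>
  outside \<open>E\<close> multiplies the size by \<open>card K\<close>, since
  \<open>k * v + e\<close> determines both \<open>k\<close> and \<open>e\<close>.\<close>

lemma card_dimension:
  fixes K :: "'a::{field,finite} set"
  assumes K: "subfield K (class_ring :: 'a ring)" and "ring.dimension class_ring d K E"
  shows "card E = card K ^ d"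
proof -
  note R = class_ring.ring_axioms[where 'a='a]
  show ?thesis using assms(2,1)
  proof (induction d K E rule: ring.dimension.induct[OF R, consumes 1, case_names zero_dim Suc_dim])
    case (zero_dim K) then show ?case by simp
  next
    case (Suc_dim v E n K)
    have sub: "subalgebra K E (class_ring :: 'a ring)"
      using ring.finite_dimension_imp_subalgebra[OF R Suc_dim.prems ring.finite_dimensionI[OF R Suc_dim.hyps(3)]] .
    have E_add: "x + y \<in> E" if "x \<in> E" "y \<in> E" for x y
      using subgroup.m_closed[OF subalgebra.axioms(1)[OF sub]] that by simp
    have E_smult: "k * x \<in> E" if "k \<in> K" "x \<in> E" for k x
      using subalgebra.smult_closed[OF sub] that by simp
    have K_sub: "x - y \<in> K" if "x \<in> K" "y \<in> K" for x y
      using subringE(5)[OF subfieldE(1)[OF Suc_dim.prems]] subringE(7)[OF subfieldE(1)[OF Suc_dim.prems], of x "- y"] that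
      by (auto simp: class_ring_simps)
    have K_inv: "inverse x \<in> K" if "x \<in> K" "x \<noteq> 0" for x
      using ring.subfield_m_inv(1)[OF R Suc_dim.prems, of x] that by (auto simp: class_ring_simps)
    have E_diff: "x - y \<in> E" if "x \<in> E" "y \<in> E" for x y
    proof -
      have "0 - 1 \<in> K" using K_sub[of 0 1] subringE(2,3)[OF subfieldE(1)[OF Suc_dim.prems]] by simp
      then have "(0 - 1) * y \<in> E" using E_smult that by blast
      then show ?thesis using E_add[of x "- y"] that by simp
    qed
    have "inj_on (\<lambda>(k, e). k * v + e) (K \<times> E)"
    proof (rule inj_onI, clarify)
      fix k e k' e'
      assume in_KE: "k \<in> K" "e \<in> E" "k' \<in> K" "e' \<in> E" and eq: "k * v + e = k' * v + e'"
      have eq': "(k - k') * v = e' - e" using eq by (simp add: algebra_simps)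
      \<comment> \<open>Otherwise \<open>k - k'\<close> is invertible in \<open>K\<close>, and
        \<open>v\<close> itself would lie in \<open>E\<close>.\<close>
      have "k = k'"
      proof (rule ccontr)
        assume "k \<noteq> k'"
        then have "inverse (k - k') \<in> K" using K_inv K_sub in_KE by simp
        then have "inverse (k - k') * ((k - k') * v) \<in> E" unfolding eq' using E_smult E_diff in_KE by blast
        then show False using \<open>v \<notin> E\<close> \<open>k \<noteq> k'\<close> by (simp add: mult.assoc[symmetric])
      qed
      then show "k = k' \<and> e = e'" using eq by simp
    qed
    moreover have "ring.line_extension class_ring K v E = (\<lambda>(k, e). k * v + e) ` (K \<times> E)"
      unfolding set_eq_iff ring.line_extension_mem_iff[OF R] by auto
    ultimately have "card (ring.line_extension class_ring K v E) = card K * card E"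
      by (simp add: card_image card_cartesian_product)
    then show ?case using Suc_dim.IH[OF Suc_dim.prems] by simp
  qed
qed

text \<open>The list of all field elements spans the field over \<open>K\<close>; this finite
  dimensionality is what makes \<open>ring.dim\<close> the actual dimension.\<close>

lemma card_UNIV_eq_power_ext_degree:
  fixes K :: "'a::{field,finite} set"
  assumes K: "subfield K (class_ring :: 'a ring)"
  shows "CARD('a) = card K ^ ext_degree K"
proof -
  note R = class_ring.ring_axioms[where 'a='a]
  obtain us where us: "set us = (UNIV :: 'a set)" using finite_list[of "UNIV :: 'a set"] by auto
  have "UNIV \<subseteq> ring.Span class_ring K us" using ring.Span_base_incl[OF R K, of us] us by simp
  then have "ring.finite_dimension class_ring K (UNIV :: 'a set)"
    using ring.Span_finite_dimension[OF R K, of us] by (simp add: top.extremum_unique)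
  from ring.finite_dimensionE[OF R K this] show ?thesis
    unfolding ext_degree_def over_def by (rule card_dimension[OF K])
qed

lemma
  fixes K :: "'a::field set"
  assumes "subfield K (class_ring :: 'a ring)"
  shows subfield_zero: "0 \<in> K" and subfield_one: "1 \<in> K"
    and subfield_add: "\<And>x y. x \<in> K \<Longrightarrow> y \<in> K \<Longrightarrow> x + y \<in> K"
    and subfield_mult: "\<And>x y. x \<in> K \<Longrightarrow> y \<in> K \<Longrightarrow> x * y \<in> K"
    and subfield_diff: "\<And>x y. x \<in> K \<Longrightarrow> y \<in> K \<Longrightarrow> x - y \<in> K"
proof -
  note sub = subfieldE(1)[OF assms]
  show "0 \<in> K" "1 \<in> K" using subringE(2,3)[OF sub] by auto
  show add: "x + y \<in> K" "x * y \<in> K" if "x \<in> K" "y \<in> K" for x y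
    using subringE(6,7)[OF sub] that by auto
  show "x - y \<in> K" if "x \<in> K" "y \<in> K" for x y
    using add(1)[of x "- y"] subringE(5)[OF sub that(2)] that by (simp add: class_ring_simps)
qed

lemma subfield_sum:
  fixes K :: "'a::field set"
  assumes "subfield K (class_ring :: 'a ring)" and "\<And>i. i \<in> I \<Longrightarrow> g i \<in> K"
  shows "sum g I \<in> K"
  using assms by (induction I rule: infinite_finite_induct) (auto simp: subfield_zero subfield_add)

lemma card_subfield_ge_2:
  fixes K :: "'a::{field,finite} set"
  assumes "subfield K (class_ring :: 'a ring)"
  shows "card K \<ge> 2"
proof -
  have "{0, 1} \<subseteq> K" using subfield_zero[OF assms] subfield_one[OF assms] by simp
  from card_mono[OF _ this] show ?thesis by simp
qed

text \<open>The kernel over \<open>K\<close> of pairing with \<open>x\<close>. It is dual to the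
  rank: large rank means few relations, so a lower bound on the distance of a code becomes an upper
  bound on a cardinality.\<close>

definition relations :: "'a::field set \<Rightarrow> 'a vec \<Rightarrow> 'a vec set" where
  "relations K x = {a \<in> vecs_over K (dim_vec x). a \<bullet> x = 0}"

lemma combine_eq_sum:
  fixes Us :: "'a::field list"
  assumes "length Ks = length Us"
  shows "ring.combine class_ring Ks Us = (\<Sum>i<length Us. Ks ! i * Us ! i)"
  using assms
proof (induction Ks Us rule: list_induct2)
  case Nil
  then show ?case by (simp add: ring.combine.simps[OF class_ring.ring_axioms])
next
  case (Cons k Ks u Us)
  then show ?case
    by (simp add: ring.combine.simps[OF class_ring.ring_axioms] sum.lessThan_Suc_shift del: sum.lessThan_Suc)
qed

text \<open>Rank-nullity for the \<open>K\<close>-linear map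
  \<open>a \<mapsto> a \<bullet> x\<close>: its kernel is \<open>relations K x\<close>, and its
  image contains the span of the coordinates.\<close>

lemma card_Span_mult_relations:
  fixes x :: "'a::{field,finite} vec"
  assumes K: "subfield K (class_ring :: 'a ring)"
  shows "card (ring.Span class_ring K (list_of_vec x)) * card (relations K x) \<le> card K ^ dim_vec x"
proof -
  let ?n = "dim_vec x" and ?f = "\<lambda>a. a \<bullet> x"
  have "card (vecs_over K ?n) = card (?f ` vecs_over K ?n) * card (relations K x)"
  proof (rule card_kernel_image[where n = ?n])
    show "finite (vecs_over K ?n)" by (simp add: finite_vecs_over)
    show "vecs_over K ?n \<subseteq> carrier_vec ?n" by (auto simp: vecs_over_def)
    show "relations K x \<subseteq> vecs_over K ?n" by (auto simp: relations_def)
    show "a + b \<in> vecs_over K ?n" if "a \<in> vecs_over K ?n" "b \<in> relations K x" for a b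
      using that by (auto simp: relations_def vecs_over_def subfield_add[OF K])
    show "a \<bullet> x = b \<bullet> x \<longleftrightarrow> a - b \<in> relations K x" if "a \<in> vecs_over K ?n" "b \<in> vecs_over K ?n" for a b
    proof -
      have c: "a \<in> carrier_vec ?n" "b \<in> carrier_vec ?n" "x \<in> carrier_vec ?n"
        using that by (auto simp: vecs_over_def)
      have "(a - b) \<bullet> x = a \<bullet> x - b \<bullet> x" using minus_scalar_prod_distrib[OF c] .
      moreover have "a - b \<in> vecs_over K ?n"
        using that by (auto simp: vecs_over_def subfield_diff[OF K])
      ultimately show ?thesis by (auto simp: relations_def)
    qed
  qed
  moreover have "ring.Span class_ring K (list_of_vec x) \<subseteq> ?f ` vecs_over K ?n"
  proof
    fix z assume "z \<in> ring.Span class_ring K (list_of_vec x)"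
    then obtain Ks where Ks: "z = ring.combine class_ring Ks (list_of_vec x)" "length Ks = ?n" "set Ks \<subseteq> K"
      using ring.Span_eq_combine_set_length_version[OF class_ring.ring_axioms K, where Us = "list_of_vec x"] by auto
    have "z = vec_of_list Ks \<bullet> x"
      using Ks(1,2) by (simp add: combine_eq_sum scalar_prod_def list_of_vec_index vec_of_list_index lessThan_atLeast0)
    moreover have "vec_of_list Ks $ i \<in> K" if "i < ?n" for i
    proof -
      have "Ks ! i \<in> set Ks" using that Ks(2) by (intro nth_mem) argo
      then show ?thesis using Ks(3) unfolding vec_of_list_index by blast
    qed
    then have "vec_of_list Ks \<in> vecs_over K ?n"
      unfolding vecs_over_def using carrier_vecI[of "vec_of_list Ks" ?n] Ks(2) by auto
    ultimately show "z \<in> ?f ` vecs_over K ?n" by blast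
  qed
  then have "card (ring.Span class_ring K (list_of_vec x)) \<le> card (?f ` vecs_over K ?n)"
    by (intro card_mono) (simp_all add: finite_vecs_over)
  ultimately show ?thesis by (simp add: card_vecs_over mult_right_mono)
qed

lemma card_relations_rank:
  fixes x :: "'a::{field,finite} vec"
  assumes K: "subfield K (class_ring :: 'a ring)" and x: "x \<in> carrier_vec N"
  shows "card K ^ rank_distance K x (0\<^sub>v N) * card (relations K x) \<le> card K ^ N"
proof -
  note R = class_ring.ring_axioms[where 'a='a]
  let ?E = "ring.Span class_ring K (list_of_vec (0\<^sub>v N - x))"
  have "ring.finite_dimension class_ring K ?E"
    using ring.Span_finite_dimension[OF R K] by simp
  from ring.finite_dimensionE[OF R K this]
  have "card ?E = card K ^ rank_distance K x (0\<^sub>v N)"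
    unfolding rank_distance_def over_def by (rule card_dimension[OF K])
  \<comment> \<open>The rank distance to zero is read from the coordinates of the negated vector; a
    sign does not change the relations.\<close>
  moreover have "relations K (0\<^sub>v N - x) = relations K x"
  proof -
    have "a \<bullet> (0\<^sub>v N - x) = - (a \<bullet> x)" if "a \<in> carrier_vec N" for a
      using scalar_prod_minus_distrib[of a N "0\<^sub>v N" x] that x by simp
    then show ?thesis using x by (auto simp: relations_def vecs_over_def)
  qed
  ultimately show ?thesis
    using card_Span_mult_relations[OF K, of "0\<^sub>v N - x"] x by simp
qed

text \<open>When the extension degree is at least \<open>N\<close>, the MRD condition gives minimum
  distance \<open>N - k + 1\<close>, so a nonzero codeword leaves room for at most q^(k-1)
  relations. The summand 1 in the distance makes the bound strict.\<close>

lemma MRD_card_relations: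
  fixes K :: "'a::{field,finite} set"
  assumes K: "subfield K (class_ring :: 'a ring)" and mrd: "MRD K N \<D>" and "ext_degree K \<ge> N" and "N > 0"
    and x: "x \<in> \<D>" "x \<noteq> 0\<^sub>v N"
  shows "card (relations K x) < card K ^ code_dim N \<D>"
proof -
  let ?k = "code_dim N \<D>" and ?d = "min_rank_distance K N \<D>" and ?q = "card K"
  have q: "?q \<ge> 2" by (rule card_subfield_ge_2[OF K])
  have lin: "linear_code N \<D>" using mrd by (simp add: MRD_def)
  then have D: "\<D> \<subseteq> carrier_vec N" by (rule linear_code_carrier)
  have Q: "CARD('a) \<ge> 2" using card_mono[of UNIV K] q by simp
  \<comment> \<open>The dimension is at most \<open>N\<close>, so the distance may be written with
    natural subtraction.\<close>
  have "CARD('a) ^ ?k \<le> CARD('a) ^ N"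
    using card_mono[OF finite_carrier_vec D] card_linear_code[OF lin] card_carrier_vec[where 'a='a] by metis
  then have k: "?k \<le> N" using Q by simp
  have "min 1 (real (ext_degree K) / real N) = 1" using assms by simp
  then have "real ?d = real N - real ?k + 1" using mrd by (simp add: MRD_def)
  then have d: "?d = N - ?k + 1" using k by linarith
  have "finite \<D>" using D finite_carrier_vec finite_subset by blast
  then have "finite {rank_distance K x (0\<^sub>v N) | x. x \<in> \<D> \<and> x \<noteq> 0\<^sub>v N}" by simp
  then have "?d \<le> rank_distance K x (0\<^sub>v N)"
    unfolding min_rank_distance_def using x by (intro Min_le) auto
  then have "?q ^ (N - ?k + 1) * card (relations K x) \<le> ?q ^ rank_distance K x (0\<^sub>v N) * card (relations K x)"
    using q unfolding d by (intro mult_right_mono power_increasing) auto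
  also have "\<dots> \<le> ?q ^ N" using card_relations_rank[OF K] x D by blast
  also have "\<dots> = ?q ^ (N - ?k) * ?q ^ ?k" using k by (simp flip: power_add)
  finally have "?q ^ (N - ?k) * (?q * card (relations K x)) \<le> ?q ^ (N - ?k) * ?q ^ ?k"
    by (simp add: ac_simps)
  then have "?q * card (relations K x) \<le> ?q ^ ?k" using q by simp
  moreover have "2 * card (relations K x) \<le> ?q * card (relations K x)" using q by (rule mult_right_mono) simp
  moreover have "?q ^ ?k > 0" using q by simp
  ultimately show ?thesis by linarith
qed

subsection \<open>Independent linear forms\<close>

text \<open>
  Independence of the linear forms \<open>x \<mapsto> v \<bullet> x\<close>, \<open>v \<in> T\<close>, is encoded dually: their joint evaluation
  map is onto. Every vector of \<open>T\<close> may have entries in the subfield while independence is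
  over the whole field.
\<close>

definition independent_forms :: "nat \<Rightarrow> 'a::field vec set \<Rightarrow> bool" where
  "independent_forms n T \<longleftrightarrow> finite T \<and> T \<subseteq> carrier_vec n \<and>
     (T \<rightarrow>\<^sub>E UNIV) \<subseteq> (\<lambda>x. \<lambda>v\<in>T. v \<bullet> x) ` carrier_vec n"

lemma independent_forms_empty: "independent_forms n {}"
  by (auto simp: independent_forms_def intro!: image_eqI[of _ _ "0\<^sub>v n"])

text \<open>A vector \<open>x\<close> killed by \<open>T\<close> but not by \<open>w\<close> can be
  added to any solution for \<open>T\<close> without changing its values there, which frees the
  value at \<open>w\<close>.\<close>

lemma independent_forms_insert:
  assumes T: "independent_forms n T" and x: "x \<in> carrier_vec n" "\<forall>v\<in>T. v \<bullet> x = 0"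
    and w: "w \<in> carrier_vec n" "w \<bullet> x \<noteq> 0"
  shows "independent_forms n (insert w T)"
  unfolding independent_forms_def
proof (intro conjI subsetI)
  show "finite (insert w T)" "\<And>v. v \<in> insert w T \<Longrightarrow> v \<in> carrier_vec n"
    using T w by (auto simp: independent_forms_def)
  fix g assume g: "g \<in> insert w T \<rightarrow>\<^sub>E (UNIV :: 'a set)"
  have "restrict g T \<in> T \<rightarrow>\<^sub>E UNIV" by simp
  then obtain y where y: "y \<in> carrier_vec n" "restrict g T = (\<lambda>v\<in>T. v \<bullet> y)"
    using T unfolding independent_forms_def by blast
  have gy: "g v = v \<bullet> y" if "v \<in> T" for v using fun_cong[OF y(2), of v] that by simp
  have "w \<notin> T" using x w by blast
  \<comment> \<open>The multiple of \<open>x\<close> is chosen to move the value at \<open>w\<close>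
    from \<open>w \<bullet> y\<close> to the prescribed \<open>g w\<close>.\<close>
  let ?z = "y + ((g w - w \<bullet> y) / (w \<bullet> x)) \<cdot>\<^sub>v x"
  have z: "v \<bullet> ?z = v \<bullet> y + ((g w - w \<bullet> y) / (w \<bullet> x)) * (v \<bullet> x)" if "v \<in> carrier_vec n" for v
    using that x y by (simp add: scalar_prod_add_distrib[of v n])
  have "g = (\<lambda>v\<in>insert w T. v \<bullet> ?z)"
  proof
    fix v
    have "v \<bullet> ?z = g v" if "v \<in> T"
      using z[of v] gy[OF that] x that T by (auto simp: independent_forms_def)
    moreover have "w \<bullet> ?z = g w" using z[OF w(1)] w(2) by simp
    ultimately show "g v = (\<lambda>v\<in>insert w T. v \<bullet> ?z) v"
      using g by (auto simp: PiE_iff extensional_def)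
  qed
  moreover have "?z \<in> carrier_vec n" using x y by simp
  ultimately show "g \<in> (\<lambda>x. \<lambda>v\<in>insert w T. v \<bullet> x) ` carrier_vec n" by blast
qed

text \<open>Greedy selection: a form is added exactly when it does not vanish on the common kernel
  of those chosen before. The result serves as a row basis consisting of members of
  \<open>R\<close>, with the same common kernel.\<close>

lemma independent_forms_subset:
  assumes "finite R" and "R \<subseteq> carrier_vec n"
  shows "\<exists>T\<subseteq>R. independent_forms n T \<and>
    (\<forall>x\<in>carrier_vec n. (\<forall>v\<in>T. v \<bullet> x = 0) \<longrightarrow> (\<forall>v\<in>R. v \<bullet> x = 0))"
  using assms
proof (induction R rule: finite_induct)
  case empty
  then show ?case using independent_forms_empty by auto
next
  case (insert w R)
  then obtain T where T: "T \<subseteq> R" "independent_forms n T"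
    "\<forall>x\<in>carrier_vec n. (\<forall>v\<in>T. v \<bullet> x = 0) \<longrightarrow> (\<forall>v\<in>R. v \<bullet> x = 0)" by auto
  show ?case
  proof (cases "\<forall>x\<in>carrier_vec n. (\<forall>v\<in>T. v \<bullet> x = 0) \<longrightarrow> w \<bullet> x = 0")
    case True
    then show ?thesis using T by (intro exI[of _ T]) auto
  next
    case False
    then obtain x where "x \<in> carrier_vec n" "\<forall>v\<in>T. v \<bullet> x = 0" "w \<bullet> x \<noteq> 0" by auto
    then have "independent_forms n (insert w T)" using independent_forms_insert T insert.prems by auto
    then show ?thesis using T by (intro exI[of _ "insert w T"]) auto
  qed
qed

text \<open>Pigeonhole: there are fewer value functions on \<open>T\<close> than vectors of length
  \<open>n\<close>, so joint evaluation is not injective.\<close>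

lemma forms_kernel_nontrivial:
  fixes T :: "'a::{field,finite} vec set"
  assumes "finite T" and T: "T \<subseteq> carrier_vec n" and "card T < n"
  shows "\<exists>x\<in>carrier_vec n. x \<noteq> 0\<^sub>v n \<and> (\<forall>v\<in>T. v \<bullet> x = 0)"
proof (rule ccontr)
  assume none: "\<not> ?thesis"
  have "inj_on (\<lambda>x. \<lambda>v\<in>T. v \<bullet> x) (carrier_vec n)"
  proof (rule inj_onI)
    fix x y :: "'a vec"
    assume xy: "x \<in> carrier_vec n" "y \<in> carrier_vec n" and eq: "(\<lambda>v\<in>T. v \<bullet> x) = (\<lambda>v\<in>T. v \<bullet> y)"
    have "v \<bullet> (x - y) = 0" if "v \<in> T" for v
      using fun_cong[OF eq, of v] that T xy scalar_prod_diff_eq_0_iff[of v n x y] by auto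
    moreover have "x - y \<in> carrier_vec n" using xy by simp
    ultimately have "x - y = 0\<^sub>v n" using none by blast
    then show "x = y" using minus_vec_eq_0_iff[OF xy] by simp
  qed
  then have "card (carrier_vec n :: 'a vec set) \<le> card (T \<rightarrow>\<^sub>E (UNIV :: 'a set))"
    using \<open>finite T\<close> by (intro card_inj_on_le) (auto intro: finite_PiE)
  then have "CARD('a) ^ n \<le> CARD('a) ^ card T"
    using \<open>finite T\<close> by (simp add: card_carrier_vec card_PiE)
  moreover have "CARD('a) \<ge> 2" using card_mono[of UNIV "{0, 1 :: 'a}"] by simp
  ultimately show False using \<open>card T < n\<close> by simp
qed

text \<open>A nonzero common zero of the present forms has a nonzero coordinate \<open>i\<close>, so
  \<open>unit_vec n i\<close> can be added. Its entries are 0 and 1, which keeps all forms over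
  \<open>K\<close>.\<close>

lemma independent_forms_extend:
  fixes T :: "'a::{field,finite} vec set"
  assumes T: "independent_forms n T" "T \<subseteq> vecs_over K n" and K: "0 \<in> K" "1 \<in> K"
    and "card T \<le> j" "j \<le> n"
  shows "\<exists>T'. T \<subseteq> T' \<and> T' \<subseteq> vecs_over K n \<and> independent_forms n T' \<and> card T' = j"
  using assms(5,6)
proof (induction j rule: dec_induct)
  case base
  then show ?case using T by blast
next
  case (step j)
  then obtain T' where T': "T \<subseteq> T'" "T' \<subseteq> vecs_over K n" "independent_forms n T'" "card T' = j" by auto
  then have fin: "finite T'" "T' \<subseteq> carrier_vec n" by (auto simp: independent_forms_def)
  obtain x where x: "x \<in> carrier_vec n" "x \<noteq> 0\<^sub>v n" "\<forall>v\<in>T'. v \<bullet> x = 0"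
    using forms_kernel_nontrivial[OF fin] T'(4) step.prems by auto
  have "\<exists>i<n. x $ i \<noteq> 0"
  proof (rule ccontr)
    assume "\<not> ?thesis"
    then have "x = 0\<^sub>v n" using x(1) by (intro eq_vecI) auto
    then show False using x(2) by simp
  qed
  then obtain i where i: "i < n" "x $ i \<noteq> 0" by blast
  have ux: "unit_vec n i \<bullet> x \<noteq> 0" using i x(1) by simp
  then have "unit_vec n i \<notin> T'" using x(3) by blast
  moreover have "independent_forms n (insert (unit_vec n i) T')"
    using independent_forms_insert[OF T'(3) x(1,3) _ ux] by simp
  moreover have "unit_vec n i \<in> vecs_over K n" using K by (auto simp: vecs_over_def unit_vec_def)
  ultimately show ?case using T' fin by (intro exI[of _ "insert (unit_vec n i) T'"]) auto
qed

text \<open>The \<open>K\<close>-combinations of forms vanishing on \<open>y\<close> are relations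
  of \<open>y\<close>. They are pairwise distinct because independence provides dual vectors that
  read off the coefficients.\<close>

lemma card_relations_forms:
  fixes K :: "'a::{field,finite} set"
  assumes K: "subfield K (class_ring :: 'a ring)"
    and T: "independent_forms n T" "T \<subseteq> vecs_over K n"
    and y: "y \<in> carrier_vec n" "\<forall>v\<in>T. v \<bullet> y = 0"
  shows "card K ^ card T \<le> card (relations K y)"
proof -
  have fin: "finite T" "T \<subseteq> carrier_vec n" using T(1) by (auto simp: independent_forms_def)
  define h :: "('a vec \<Rightarrow> 'a) \<Rightarrow> 'a vec" where "h c = vec n (\<lambda>i. \<Sum>v\<in>T. c v * v $ i)" for c
  have hx: "h c \<bullet> x = (\<Sum>v\<in>T. c v * (v \<bullet> x))" if x: "x \<in> carrier_vec n" for c x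
  proof -
    have "h c \<bullet> x = (\<Sum>i<n. \<Sum>v\<in>T. c v * (v $ i * x $ i))"
      using x by (simp add: h_def scalar_prod_def sum_distrib_right lessThan_atLeast0 mult.assoc)
    also have "\<dots> = (\<Sum>v\<in>T. c v * (\<Sum>i<n. v $ i * x $ i))"
      by (subst sum.swap) (simp add: sum_distrib_left)
    finally show ?thesis using x by (simp add: scalar_prod_def lessThan_atLeast0)
  qed
  have "inj_on h (T \<rightarrow>\<^sub>E K)"
  proof (rule inj_onI)
    fix c d assume cd: "c \<in> T \<rightarrow>\<^sub>E K" "d \<in> T \<rightarrow>\<^sub>E K" "h c = h d"
    have "c u = d u" if u: "u \<in> T" for u
    proof -
      \<comment> \<open>Surjectivity of the evaluation gives a vector on which \<open>u\<close>
        takes the value 1 and every other form the value 0.\<close>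
      have "(\<lambda>v\<in>T. if v = u then 1 else 0) \<in> T \<rightarrow>\<^sub>E (UNIV :: 'a set)" by simp
      then obtain x where x: "x \<in> carrier_vec n" "(\<lambda>v\<in>T. if v = u then 1 else 0) = (\<lambda>v\<in>T. v \<bullet> x)"
        using T(1) unfolding independent_forms_def by blast
      have vx: "v \<bullet> x = (if v = u then 1 else 0)" if "v \<in> T" for v
        using fun_cong[OF x(2), of v] that by simp
      have "h e \<bullet> x = e u" for e
      proof -
        have "h e \<bullet> x = (\<Sum>v\<in>T. if v = u then e v else 0)"
          unfolding hx[OF x(1)] by (intro sum.cong) (simp_all add: vx)
        then show ?thesis using fin(1) u by simp
      qed
      then show ?thesis using cd(3) by metis
    qed
    then show "c = d" using cd(1,2) by (intro PiE_ext) auto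
  qed
  moreover have "h ` (T \<rightarrow>\<^sub>E K) \<subseteq> relations K y"
  proof (rule image_subsetI)
    fix c assume c: "c \<in> T \<rightarrow>\<^sub>E K"
    have "(\<Sum>v\<in>T. c v * v $ i) \<in> K" if "i < n" for i
    proof (rule subfield_sum[OF K])
      fix v assume "v \<in> T"
      then show "c v * v $ i \<in> K"
        using c T(2) that by (intro subfield_mult[OF K]) (auto simp: vecs_over_def PiE_mem)
    qed
    then show "h c \<in> relations K y"
      using hx[OF y(1), of c] y by (simp add: relations_def vecs_over_def h_def)
  qed
  moreover have "finite (relations K y)" unfolding relations_def using finite_vecs_over[of K] by simp
  ultimately have "card (T \<rightarrow>\<^sub>E K) \<le> card (relations K y)" by (intro card_inj_on_le) auto
  then show ?thesis using fin(1) by (simp add: card_PiE)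
qed

lemma vecs_over_append:
  assumes "a \<in> vecs_over K l" "b \<in> vecs_over K n"
  shows "a @\<^sub>v b \<in> vecs_over K (l + n)"
  using assms by (auto simp: vecs_over_def)

text \<open>A relation of the tail \<open>y\<close> extends by zeros to the whole word. If the head
  of the word is zero, any head over \<open>K\<close> may be put in front of the relation; this
  factor \<open>card K ^ l\<close> is why the shortened code needs \<open>l\<close> fewer forms than
  the punctured one.\<close>

lemma
  fixes K :: "'a::{field,finite} set"
  assumes K: "subfield K (class_ring :: 'a ring)" and y: "y \<in> carrier_vec n"
  shows card_relations_append: "s \<in> carrier_vec l \<Longrightarrow> card (relations K y) \<le> card (relations K (s @\<^sub>v y))"
    and card_relations_append_zero:
      "card K ^ l * card (relations K y) \<le> card (relations K (0\<^sub>v l @\<^sub>v y))"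
proof -
  have fin: "finite (relations K z)" for z :: "'a vec"
    unfolding relations_def using finite_vecs_over[of K] by simp
  have rel: "b \<in> carrier_vec n" if "b \<in> relations K y" for b
    using that y by (auto simp: relations_def vecs_over_def)
  have app: "a @\<^sub>v b \<in> relations K (s @\<^sub>v y)"
    if "a \<in> vecs_over K l" "b \<in> relations K y" "s \<in> carrier_vec l" "a \<bullet> s = 0" for a b s
  proof -
    have "a \<in> carrier_vec l" using that by (simp add: vecs_over_def)
    then have "(a @\<^sub>v b) \<bullet> (s @\<^sub>v y) = 0"
      using scalar_prod_append[of a l b n s y] that y rel by (simp add: relations_def)
    then show ?thesis using that y by (auto simp: relations_def intro: vecs_over_append)
  qed
  show "card (relations K y) \<le> card (relations K (s @\<^sub>v y))" if s: "s \<in> carrier_vec l"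
  proof (rule card_inj_on_le[OF _ _ fin])
    show "inj_on ((@\<^sub>v) (0\<^sub>v l)) (relations K y)"
      by (rule inj_onI) (simp add: append_vec_eq[of _ l])
    have "0\<^sub>v l \<in> vecs_over K l" using subfield_zero[OF K] by (auto simp: vecs_over_def)
    then show "(@\<^sub>v) (0\<^sub>v l) ` relations K y \<subseteq> relations K (s @\<^sub>v y)" using app s by auto
  qed
  have "card (vecs_over K l \<times> relations K y) \<le> card (relations K (0\<^sub>v l @\<^sub>v y))"
  proof (rule card_inj_on_le[OF _ _ fin])
    show "inj_on (\<lambda>(a, b). a @\<^sub>v b) (vecs_over K l \<times> relations K y)"
    proof (rule inj_onI, clarify)
      fix a b a' b'
      assume "a \<in> vecs_over K l" "a' \<in> vecs_over K l" "a @\<^sub>v b = a' @\<^sub>v b'"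
      moreover have "a \<in> carrier_vec l" "a' \<in> carrier_vec l" using calculation by (auto simp: vecs_over_def)
      ultimately show "a = a' \<and> b = b'" using append_vec_eq[of a l a' b b'] by simp
    qed
    have "a \<bullet> 0\<^sub>v l = 0" if "a \<in> vecs_over K l" for a using that by (simp add: vecs_over_def)
    then show "(\<lambda>(a, b). a @\<^sub>v b) ` (vecs_over K l \<times> relations K y) \<subseteq> relations K (0\<^sub>v l @\<^sub>v y)"
      using app[of _ _ "0\<^sub>v l"] by auto
  qed
  then show "card K ^ l * card (relations K y) \<le> card (relations K (0\<^sub>v l @\<^sub>v y))"
    by (simp add: card_cartesian_product card_vecs_over)
qed

subsection \<open>Punctured and shortened codes\<close>

lemma vec_first_append:
  assumes "s \<in> carrier_vec l"
  shows "vec_first (s @\<^sub>v y) l = s"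
  using assms by (intro eq_vecI) (auto simp: vec_first_def)

lemma vec_last_append:
  assumes "y \<in> carrier_vec n"
  shows "vec_last (s @\<^sub>v y) n = y"
  using assms by (intro eq_vecI) (auto simp: vec_last_def)

lemma punctured_code_iff:
  assumes "D \<subseteq> carrier_vec (l + n)"
  shows "y \<in> punctured_code n D \<longleftrightarrow> y \<in> carrier_vec n \<and> (\<exists>s\<in>carrier_vec l. s @\<^sub>v y \<in> D)"
proof
  assume "y \<in> punctured_code n D"
  then obtain v where v: "v \<in> D" "y = vec_last v n" by (auto simp: punctured_code_def)
  then have "vec_first v l @\<^sub>v y \<in> D" using assms vec_first_last_append[of v l n] by auto
  then show "y \<in> carrier_vec n \<and> (\<exists>s\<in>carrier_vec l. s @\<^sub>v y \<in> D)" using v by auto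
next
  assume "y \<in> carrier_vec n \<and> (\<exists>s\<in>carrier_vec l. s @\<^sub>v y \<in> D)"
  then show "y \<in> punctured_code n D" unfolding punctured_code_def using vec_last_append by (metis imageI)
qed

lemma shortened_code_iff:
  fixes D :: "'a::zero vec set"
  assumes "D \<subseteq> carrier_vec (l + n)"
  shows "y \<in> shortened_code l n D \<longleftrightarrow> y \<in> carrier_vec n \<and> 0\<^sub>v l @\<^sub>v y \<in> D"
proof
  assume "y \<in> shortened_code l n D"
  then obtain v where v: "v \<in> D" "vec_first v l = 0\<^sub>v l" "y = vec_last v n" by (auto simp: shortened_code_def)
  then have "0\<^sub>v l @\<^sub>v y \<in> D" using assms vec_first_last_append[of v l n] by auto
  then show "y \<in> carrier_vec n \<and> 0\<^sub>v l @\<^sub>v y \<in> D" using v by auto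
next
  assume y: "y \<in> carrier_vec n \<and> 0\<^sub>v l @\<^sub>v y \<in> D"
  then show "y \<in> shortened_code l n D"
    unfolding shortened_code_def
    by (intro image_eqI[of _ _ "0\<^sub>v l @\<^sub>v y"]) (auto simp: vec_last_append vec_first_append)
qed

lemma linear_punctured_code:
  fixes D :: "'a::field vec set"
  assumes D: "linear_code (l + n) D"
  shows "linear_code n (punctured_code n D)"
proof (rule linear_codeI)
  note iff = punctured_code_iff[OF linear_code_carrier[OF D]]
  show "punctured_code n D \<subseteq> carrier_vec n" using iff by blast
  have "0\<^sub>v l @\<^sub>v 0\<^sub>v n = (0\<^sub>v (l + n) :: 'a vec)" by (intro eq_vecI) auto
  then show "0\<^sub>v n \<in> punctured_code n D" using iff linear_code_zero[OF D] by (metis zero_carrier_vec)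
  show "x + y \<in> punctured_code n D" if x: "x \<in> punctured_code n D" and y: "y \<in> punctured_code n D" for x y
  proof -
    obtain s where s: "x \<in> carrier_vec n" "s \<in> carrier_vec l" "s @\<^sub>v x \<in> D"
      using x unfolding iff by auto
    obtain t where t: "y \<in> carrier_vec n" "t \<in> carrier_vec l" "t @\<^sub>v y \<in> D"
      using y unfolding iff by auto
    have "(s + t) @\<^sub>v (x + y) \<in> D"
      using linear_code_add[OF D s(3) t(3)] append_vec_add[OF s(2) t(2) s(1) t(1)] by simp
    then show ?thesis unfolding iff using s t by (intro conjI bexI[of _ "s + t"]) auto
  qed
  show "c \<cdot>\<^sub>v x \<in> punctured_code n D" if x: "x \<in> punctured_code n D" for c x
  proof -
    obtain s where s: "x \<in> carrier_vec n" "s \<in> carrier_vec l" "s @\<^sub>v x \<in> D"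
      using x unfolding iff by auto
    have "(c \<cdot>\<^sub>v s) @\<^sub>v (c \<cdot>\<^sub>v x) = c \<cdot>\<^sub>v (s @\<^sub>v x)" using s by (intro eq_vecI) auto
    then have "(c \<cdot>\<^sub>v s) @\<^sub>v (c \<cdot>\<^sub>v x) \<in> D" using linear_code_smult[OF D s(3)] by simp
    then show ?thesis unfolding iff using s by (intro conjI bexI[of _ "c \<cdot>\<^sub>v s"]) auto
  qed
qed

lemma linear_shortened_code:
  fixes D :: "'a::field vec set"
  assumes D: "linear_code (l + n) D"
  shows "linear_code n (shortened_code l n D)"
proof (rule linear_codeI)
  note iff = shortened_code_iff[OF linear_code_carrier[OF D]]
  show "shortened_code l n D \<subseteq> carrier_vec n" using iff by blast
  have "0\<^sub>v l @\<^sub>v 0\<^sub>v n = (0\<^sub>v (l + n) :: 'a vec)" by (intro eq_vecI) auto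
  then show "0\<^sub>v n \<in> shortened_code l n D" using iff linear_code_zero[OF D] by simp
  show "x + y \<in> shortened_code l n D" if "x \<in> shortened_code l n D" "y \<in> shortened_code l n D" for x y
    using that linear_code_add[OF D, of "0\<^sub>v l @\<^sub>v x" "0\<^sub>v l @\<^sub>v y"] append_vec_add[of "0\<^sub>v l" l "0\<^sub>v l" x n y]
    unfolding iff by simp
  show "c \<cdot>\<^sub>v x \<in> shortened_code l n D" if "x \<in> shortened_code l n D" for c x
  proof -
    have x: "x \<in> carrier_vec n" "0\<^sub>v l @\<^sub>v x \<in> D" using that unfolding iff by auto
    have "0\<^sub>v l @\<^sub>v (c \<cdot>\<^sub>v x) = c \<cdot>\<^sub>v (0\<^sub>v l @\<^sub>v x)" using x by (intro eq_vecI) auto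
    then show ?thesis using linear_code_smult[OF D x(2)] x unfolding iff by simp
  qed
qed

text \<open>The coefficient vector \<open>s\<close> padded with zeros combines only the rows of the
  first block, giving a codeword with head \<open>s\<close> whose tail is the coset
  representative.\<close>

lemma encode_in_row_space:
  fixes \<Delta>G G\<^sub>2 :: "'a::field mat"
  assumes \<Delta>G: "\<Delta>G \<in> carrier_mat l n" and G\<^sub>2: "G\<^sub>2 \<in> carrier_mat r n" and s: "s \<in> carrier_vec l"
  shows "s @\<^sub>v (\<Delta>G\<^sup>T *\<^sub>v s) \<in> vec_space.row_space (l + n) (four_block_mat (1\<^sub>m l) \<Delta>G (0\<^sub>m r l) G\<^sub>2)"
proof -
  let ?G = "four_block_mat (1\<^sub>m l) \<Delta>G (0\<^sub>m r l) G\<^sub>2"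
  have G: "?G \<in> carrier_mat (l + r) (l + n)" using \<Delta>G G\<^sub>2 by auto
  have tr: "?G\<^sup>T = four_block_mat (1\<^sub>m l) (0\<^sub>m l r) \<Delta>G\<^sup>T G\<^sub>2\<^sup>T"
    using transpose_four_block_mat[OF one_carrier_mat \<Delta>G zero_carrier_mat G\<^sub>2] by simp
  have gc: "\<Delta>G\<^sup>T *\<^sub>v s \<in> carrier_vec n" using \<Delta>G s by (intro mult_mat_vec_carrier[of _ n l]) auto
  have "?G\<^sup>T *\<^sub>v (s @\<^sub>v 0\<^sub>v r) = (1\<^sub>m l *\<^sub>v s + 0\<^sub>m l r *\<^sub>v 0\<^sub>v r) @\<^sub>v (\<Delta>G\<^sup>T *\<^sub>v s + G\<^sub>2\<^sup>T *\<^sub>v 0\<^sub>v r)"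
    unfolding tr using \<Delta>G G\<^sub>2 s by (intro four_block_mat_mult_vec) auto
  also have "1\<^sub>m l *\<^sub>v s + 0\<^sub>m l r *\<^sub>v 0\<^sub>v r = s" using s by (intro eq_vecI) auto
  also have "\<Delta>G\<^sup>T *\<^sub>v s + G\<^sub>2\<^sup>T *\<^sub>v 0\<^sub>v r = \<Delta>G\<^sup>T *\<^sub>v s"
  proof -
    have "G\<^sub>2\<^sup>T *\<^sub>v 0\<^sub>v r = 0\<^sub>v n" using G\<^sub>2 by (intro eq_vecI) auto
    then show ?thesis using gc by simp
  qed
  finally have "?G\<^sup>T *\<^sub>v (s @\<^sub>v 0\<^sub>v r) = s @\<^sub>v (\<Delta>G\<^sup>T *\<^sub>v s)" .
  moreover have "s @\<^sub>v 0\<^sub>v r \<in> carrier_vec (l + r)" using s by simp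
  moreover have "s @\<^sub>v (\<Delta>G\<^sup>T *\<^sub>v s) \<in> carrier_vec (l + n)" using s gc by simp
  ultimately show ?thesis
    unfolding vec_space.row_space_eq[OF G] using G by (metis (mono_tags, lifting) carrier_matD mem_Collect_eq)
qed

subsection \<open>Nested coset coding from an MRD code\<close>

text \<open>The generator matrix is represented by \<open>encode\<close>: for each head
  \<open>s\<close> it supplies a codeword whose tail represents the coset of
  \<open>s\<close>.\<close>

locale nested_coset_scheme =
  fixes K :: "'a::{field,finite} set" and D :: "'a vec set" and \<Delta>G :: "'a mat" and l n k :: nat
  assumes K: "subfield K (class_ring :: 'a ring)"
    and mrd: "MRD K (l + n) D" and degree: "l + n \<le> ext_degree K"
    and dim: "code_dim (l + n) D = k"
    and n_pos: "1 \<le> n" and l_le: "l \<le> k" and k_le: "k \<le> n"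
    and \<Delta>G: "\<Delta>G \<in> carrier_mat l n"
    and encode: "\<And>s. s \<in> carrier_vec l \<Longrightarrow> s @\<^sub>v (\<Delta>G\<^sup>T *\<^sub>v s) \<in> D"
begin

abbreviation C\<^sub>1 where "C\<^sub>1 \<equiv> punctured_code n D"
abbreviation C\<^sub>2 where "C\<^sub>2 \<equiv> shortened_code l n D"
abbreviation \<psi> where "\<psi> \<equiv> coset_map \<Delta>G C\<^sub>2"

text \<open>Restricted to \<open>T\<close>, so that the values are extensional functions and can be
  counted in \<open>T \<rightarrow>\<^sub>E UNIV\<close>.\<close>

abbreviation ev :: "'a vec set \<Rightarrow> 'a vec \<Rightarrow> 'a vec \<Rightarrow> 'a" where
  "ev T x \<equiv> \<lambda>v\<in>T. v \<bullet> x"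

lemma lin_D: "linear_code (l + n) D"
  using mrd by (simp add: MRD_def)

lemma D_carrier: "D \<subseteq> carrier_vec (l + n)"
  by (rule linear_code_carrier[OF lin_D])

lemmas C\<^sub>1_iff = punctured_code_iff[OF D_carrier]
lemmas C\<^sub>2_iff = shortened_code_iff[OF D_carrier]
lemmas lin_C\<^sub>1 = linear_punctured_code[OF lin_D]
lemmas lin_C\<^sub>2 = linear_shortened_code[OF lin_D]

lemma C\<^sub>1_carrier: "C\<^sub>1 \<subseteq> carrier_vec n"
  by (rule linear_code_carrier[OF lin_C\<^sub>1])

lemma C\<^sub>2_carrier: "C\<^sub>2 \<subseteq> carrier_vec n"
  by (rule linear_code_carrier[OF lin_C\<^sub>2])

lemma finite_C\<^sub>1: "finite C\<^sub>1" and finite_C\<^sub>2: "finite C\<^sub>2"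
  using C\<^sub>1_carrier C\<^sub>2_carrier finite_carrier_vec finite_subset by blast+

lemma order_ge_2: "CARD('a) \<ge> 2"
  using card_mono[of UNIV "{0, 1 :: 'a}"] by simp

lemma append_diff_in_D:
  assumes "s @\<^sub>v x \<in> D" "t @\<^sub>v y \<in> D" "s \<in> carrier_vec l" "t \<in> carrier_vec l" "x \<in> carrier_vec n" "y \<in> carrier_vec n"
  shows "(s - t) @\<^sub>v (x - y) \<in> D"
proof -
  have "(s - t) @\<^sub>v (x - y) = (s @\<^sub>v x) - (t @\<^sub>v y)" using assms by (intro eq_vecI) auto
  then show ?thesis using linear_code_diff[OF lin_D assms(1,2)] by simp
qed

text \<open>Subtracting the codeword supplied by \<open>encode\<close> turns a codeword with head
  \<open>s\<close> into one with head zero. The coset is thereby described as the set of tails that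
  complete \<open>s\<close>, without reference to \<open>\<Delta>G\<close>.\<close>

lemma coset_map_iff:
  assumes s: "s \<in> carrier_vec l"
  shows "x \<in> \<psi> s \<longleftrightarrow> x \<in> carrier_vec n \<and> s @\<^sub>v x \<in> D"
proof
  let ?g = "\<Delta>G\<^sup>T *\<^sub>v s"
  have g: "?g \<in> carrier_vec n" using \<Delta>G s by (intro mult_mat_vec_carrier[of _ n l]) auto
  {
    assume "x \<in> \<psi> s"
    then obtain c where c: "c \<in> C\<^sub>2" "x = ?g + c" by (auto simp: coset_map_def)
    then have c': "c \<in> carrier_vec n" "0\<^sub>v l @\<^sub>v c \<in> D" using C\<^sub>2_iff by auto
    have "s @\<^sub>v x = (s @\<^sub>v ?g) + (0\<^sub>v l @\<^sub>v c)"
      using append_vec_add[OF s zero_carrier_vec g c'(1)] s c(2) by simp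
    then show "x \<in> carrier_vec n \<and> s @\<^sub>v x \<in> D"
      using linear_code_add[OF lin_D encode[OF s] c'(2)] g c c' by simp
  }
  assume x: "x \<in> carrier_vec n \<and> s @\<^sub>v x \<in> D"
  then have "(s - s) @\<^sub>v (x - ?g) \<in> D" using append_diff_in_D encode[OF s] s g by blast
  then have "x - ?g \<in> C\<^sub>2" using C\<^sub>2_iff x s g by simp
  moreover have "x = ?g + (x - ?g)" using add_vec_diff[OF g] x by simp
  ultimately show "x \<in> \<psi> s" unfolding coset_map_def by blast
qed

lemma coset_map_subset: "s \<in> carrier_vec l \<Longrightarrow> \<psi> s \<subseteq> C\<^sub>1"
  using coset_map_iff C\<^sub>1_iff by blast

lemma card_coset_map:
  assumes s: "s \<in> carrier_vec l"
  shows "card (\<psi> s) = card C\<^sub>2"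
proof -
  let ?g = "\<Delta>G\<^sup>T *\<^sub>v s"
  have g: "?g \<in> carrier_vec n" using \<Delta>G s by (intro mult_mat_vec_carrier[of _ n l]) auto
  have "inj_on ((+) ?g) C\<^sub>2"
  proof (rule inj_onI)
    fix u v assume uv: "u \<in> C\<^sub>2" "v \<in> C\<^sub>2" "?g + u = ?g + v"
    then have "u \<in> carrier_vec n" "v \<in> carrier_vec n" using C\<^sub>2_carrier by auto
    then have "?g + u - ?g = u" "?g + v - ?g = v" using add_vec_diff_cancel[OF g] by blast+
    then show "u = v" using uv(3) by metis
  qed
  then show ?thesis unfolding coset_map_def by (rule card_image)
qed

text \<open>Forms vanishing on the tail already give q^k relations of the whole word, too many for a
  nonzero codeword. The conclusion covers the head too, although the forms see only the
  tail.\<close>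

lemma MRD_separates:
  assumes T: "independent_forms n T" "T \<subseteq> vecs_over K n" "k \<le> card T"
    and sy: "s \<in> carrier_vec l" "y \<in> carrier_vec n" "s @\<^sub>v y \<in> D" and zero: "\<forall>v\<in>T. v \<bullet> y = 0"
  shows "s @\<^sub>v y = 0\<^sub>v (l + n)"
proof (rule ccontr)
  assume "s @\<^sub>v y \<noteq> 0\<^sub>v (l + n)"
  then have "card (relations K (s @\<^sub>v y)) < card K ^ k"
    using MRD_card_relations[OF K mrd degree _ sy(3)] n_pos dim by simp
  also have "\<dots> \<le> card K ^ card T" using card_subfield_ge_2[OF K] T(3) by (intro power_increasing) auto
  also have "\<dots> \<le> card (relations K y)" by (rule card_relations_forms[OF K T(1,2) sy(2) zero])
  also have "\<dots> \<le> card (relations K (s @\<^sub>v y))" by (rule card_relations_append[OF K sy(2,1)])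
  finally show False by simp
qed

text \<open>The zero head contributes the factor \<open>card K ^ l\<close>, so \<open>k - l\<close>
  forms are enough to reach q^k relations.\<close>

lemma MRD_separates_shortened:
  assumes T: "independent_forms n T" "T \<subseteq> vecs_over K n" "k - l \<le> card T"
    and y: "y \<in> C\<^sub>2" and zero: "\<forall>v\<in>T. v \<bullet> y = 0"
  shows "y = 0\<^sub>v n"
proof (rule ccontr)
  assume "y \<noteq> 0\<^sub>v n"
  have yc: "y \<in> carrier_vec n" "0\<^sub>v l @\<^sub>v y \<in> D" using y C\<^sub>2_iff by auto
  have "0\<^sub>v (l + n) = 0\<^sub>v l @\<^sub>v (0\<^sub>v n :: 'a vec)" by (intro eq_vecI) auto
  then have "0\<^sub>v l @\<^sub>v y \<noteq> 0\<^sub>v (l + n)" using \<open>y \<noteq> 0\<^sub>v n\<close> by (simp add: append_vec_eq[of _ l])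
  then have "card (relations K (0\<^sub>v l @\<^sub>v y)) < card K ^ k"
    using MRD_card_relations[OF K mrd degree _ yc(2)] n_pos dim by simp
  also have "\<dots> \<le> card K ^ (l + card T)" using card_subfield_ge_2[OF K] T(3) by (intro power_increasing) auto
  also have "\<dots> \<le> card K ^ l * card (relations K y)"
    using card_relations_forms[OF K T(1,2) yc(1) zero] by (simp add: power_add)
  also have "\<dots> \<le> card (relations K (0\<^sub>v l @\<^sub>v y))" by (rule card_relations_append_zero[OF K yc(1)])
  finally show False by simp
qed

section \<open>Joint evaluation of forms on the codes\<close>

lemma ev_PiE: "ev T x \<in> T \<rightarrow>\<^sub>E UNIV"
  by simp

lemma ev_eq_iff:
  assumes "T \<subseteq> carrier_vec n" "x \<in> carrier_vec n" "y \<in> carrier_vec n"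
  shows "ev T x = ev T y \<longleftrightarrow> (\<forall>v\<in>T. v \<bullet> (x - y) = 0)"
proof -
  have "v \<bullet> x = v \<bullet> y \<longleftrightarrow> v \<bullet> (x - y) = 0" if "v \<in> T" for v
    using scalar_prod_diff_eq_0_iff[of v n x y] that assms by auto
  then show ?thesis by (auto simp: fun_eq_iff restrict_def)
qed

text \<open>Separation applied to the difference of two codewords. Equality of the heads is what
  makes puncturing injective and distinct cosets disjoint.\<close>

lemma append_eq_if_ev_eq:
  assumes T: "independent_forms n T" "T \<subseteq> vecs_over K n" "k \<le> card T"
    and x: "s \<in> carrier_vec l" "x \<in> carrier_vec n" "s @\<^sub>v x \<in> D"
    and y: "t \<in> carrier_vec l" "y \<in> carrier_vec n" "t @\<^sub>v y \<in> D"
    and eq: "ev T x = ev T y"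
  shows "s = t \<and> x = y"
proof -
  have "T \<subseteq> carrier_vec n" using T(1) by (simp add: independent_forms_def)
  then have "\<forall>v\<in>T. v \<bullet> (x - y) = 0" using eq ev_eq_iff x y by blast
  then have "(s - t) @\<^sub>v (x - y) = 0\<^sub>v (l + n)"
    using MRD_separates[OF T] append_diff_in_D x y by simp
  also have "0\<^sub>v (l + n) = 0\<^sub>v l @\<^sub>v (0\<^sub>v n :: 'a vec)" by (intro eq_vecI) auto
  finally have "s - t = 0\<^sub>v l" "x - y = 0\<^sub>v n" using x y append_vec_eq[of "s - t" l "0\<^sub>v l" "x - y" "0\<^sub>v n"] by auto
  then show ?thesis using x y minus_vec_eq_0_iff by blast
qed

lemma inj_on_ev_C\<^sub>1:
  assumes "independent_forms n T" "T \<subseteq> vecs_over K n" "k \<le> card T"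
  shows "inj_on (ev T) C\<^sub>1"
proof (rule inj_onI)
  fix x y assume x: "x \<in> C\<^sub>1" and y: "y \<in> C\<^sub>1" and eq: "ev T x = ev T y"
  from x obtain s where "s \<in> carrier_vec l" "x \<in> carrier_vec n" "s @\<^sub>v x \<in> D" unfolding C\<^sub>1_iff by auto
  moreover from y obtain t where "t \<in> carrier_vec l" "y \<in> carrier_vec n" "t @\<^sub>v y \<in> D" unfolding C\<^sub>1_iff by auto
  ultimately show "x = y" using append_eq_if_ev_eq[OF assms _ _ _ _ _ _ eq] by simp
qed

lemma inj_on_ev_C\<^sub>2:
  assumes T: "independent_forms n T" "T \<subseteq> vecs_over K n" "k - l \<le> card T"
  shows "inj_on (ev T) C\<^sub>2"
proof (rule inj_onI)
  fix x y assume xy: "x \<in> C\<^sub>2" "y \<in> C\<^sub>2" and eq: "ev T x = ev T y"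
  then have c: "x \<in> carrier_vec n" "y \<in> carrier_vec n" using C\<^sub>2_carrier by auto
  have "T \<subseteq> carrier_vec n" using T(1) by (simp add: independent_forms_def)
  then have "\<forall>v\<in>T. v \<bullet> (x - y) = 0" using eq ev_eq_iff c by blast
  then have "x - y = 0\<^sub>v n" using MRD_separates_shortened[OF T] linear_code_diff[OF lin_C\<^sub>2 xy] by blast
  then show "x = y" using minus_vec_eq_0_iff c by blast
qed

lemma exists_forms:
  assumes "j \<le> n"
  shows "\<exists>T. independent_forms n T \<and> T \<subseteq> vecs_over K n \<and> card T = j"
  using independent_forms_extend[OF independent_forms_empty _ subfield_zero[OF K] subfield_one[OF K], of n j] assms
  by auto

text \<open>Since \<open>k \<le> n\<close>, there are \<open>k\<close> independent forms; a common
  tail has the same values under them, which forces the two heads to agree.\<close>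

lemma coset_map_disjoint:
  assumes "s \<in> carrier_vec l" "t \<in> carrier_vec l" "x \<in> \<psi> s" "x \<in> \<psi> t"
  shows "s = t"
proof -
  obtain T where T: "independent_forms n T" "T \<subseteq> vecs_over K n" "card T = k"
    using exists_forms[OF k_le] by blast
  then show ?thesis using append_eq_if_ev_eq[OF T(1,2), of s x t x] assms coset_map_iff by auto
qed

section \<open>Sizes and dimensions of the nested codes\<close>

lemma card_D: "card D = CARD('a) ^ k"
  using card_linear_code[OF lin_D] dim by simp

lemma card_C\<^sub>1: "card C\<^sub>1 = CARD('a) ^ k"
proof -
  obtain T where T: "independent_forms n T" "T \<subseteq> vecs_over K n" "card T = k"
    using exists_forms[OF k_le] by blast
  have "inj_on (\<lambda>v. vec_last v n) D"
  proof (rule inj_onI)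
    fix v w assume vw: "v \<in> D" "w \<in> D" "vec_last v n = vec_last w n"
    then have eq: "vec_first v l @\<^sub>v vec_last v n = v" "vec_first w l @\<^sub>v vec_last w n = w"
      using D_carrier vec_first_last_append by blast+
    have "vec_first v l = vec_first w l \<and> vec_last v n = vec_last w n"
      using append_eq_if_ev_eq[OF T(1,2), of "vec_first v l" "vec_last v n" "vec_first w l" "vec_last w n"]
        vw eq T(3) by simp
    then show "v = w" using eq by metis
  qed
  then show ?thesis unfolding punctured_code_def by (simp add: card_image card_D)
qed

text \<open>Sorting codewords by head splits \<open>D\<close> into one piece for each of the Q^l
  heads, and each piece is a coset as large as \<open>C\<^sub>2\<close>.\<close>

lemma card_C\<^sub>2: "card C\<^sub>2 = CARD('a) ^ (k - l)"
proof -
  have split: "D = (\<lambda>(s, x). s @\<^sub>v x) ` Sigma (carrier_vec l) \<psi>"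
  proof (intro equalityI subsetI)
    fix v assume v: "v \<in> D"
    then have eq: "vec_first v l @\<^sub>v vec_last v n = v" using D_carrier vec_first_last_append by blast
    then have "vec_last v n \<in> \<psi> (vec_first v l)" using v by (simp add: coset_map_iff)
    then show "v \<in> (\<lambda>(s, x). s @\<^sub>v x) ` Sigma (carrier_vec l) \<psi>"
      using eq by (intro image_eqI[of _ _ "(vec_first v l, vec_last v n)"]) auto
  qed (auto simp: coset_map_iff)
  have "inj_on (\<lambda>(s, x). s @\<^sub>v x) (Sigma (carrier_vec l) \<psi>)"
    by (rule inj_onI) (auto simp: append_vec_eq[of _ l])
  then have "card D = card (Sigma (carrier_vec l) \<psi>)"
    using trans[OF arg_cong[OF split, of card] card_image] by blast
  also have "\<dots> = (\<Sum>s\<in>carrier_vec l. card (\<psi> s))"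
    using coset_map_subset finite_C\<^sub>1 finite_subset by (intro card_SigmaI finite_carrier_vec) blast
  also have "\<dots> = (\<Sum>s\<in>(carrier_vec l :: 'a vec set). card C\<^sub>2)" by (intro sum.cong card_coset_map refl)
  also have "\<dots> = CARD('a) ^ l * card C\<^sub>2" by (simp add: card_carrier_vec)
  finally have "CARD('a) ^ l * card C\<^sub>2 = CARD('a) ^ l * CARD('a) ^ (k - l)"
    using card_D l_le by (simp flip: power_add)
  then show ?thesis using order_ge_2 by simp
qed

lemma code_dim_C\<^sub>1: "code_dim n C\<^sub>1 = k"
  using card_linear_code[OF lin_C\<^sub>1] card_C\<^sub>1 order_ge_2 by simp

lemma code_dim_C\<^sub>2: "code_dim n C\<^sub>2 = k - l"
  using card_linear_code[OF lin_C\<^sub>2] card_C\<^sub>2 order_ge_2 by simp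

section \<open>Images of the codes under an observation matrix\<close>

lemma mult_mat_vec_diff_eq_0_iff:
  fixes B :: "'a mat"
  assumes "B \<in> carrier_mat \<mu> n" "x \<in> carrier_vec n" "y \<in> carrier_vec n"
  shows "B *\<^sub>v x = B *\<^sub>v y \<longleftrightarrow> B *\<^sub>v (x - y) = 0\<^sub>v \<mu>"
  using mult_minus_distrib_mat_vec[OF assms] minus_vec_eq_0_iff[of "B *\<^sub>v x" \<mu> "B *\<^sub>v y"] assms by simp

text \<open>Differences from a fixed point of the fibre lie in the kernel of \<open>B\<close> on
  \<open>C\<^sub>2\<close>, whose size follows from that of the image. The inequality also covers
  empty fibres.\<close>

lemma card_fibre_coset:
  assumes B: "B \<in> carrier_mat \<mu> n" and s: "s \<in> carrier_vec l"
  shows "card {x \<in> \<psi> s. B *\<^sub>v x = y} * card ((*\<^sub>v) B ` C\<^sub>2) \<le> card C\<^sub>2"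
proof -
  let ?N = "{c \<in> C\<^sub>2. B *\<^sub>v c = 0\<^sub>v \<mu>}"
  have "card C\<^sub>2 = card ((*\<^sub>v) B ` C\<^sub>2) * card ?N"
  proof (rule card_kernel_image[OF finite_C\<^sub>2 C\<^sub>2_carrier])
    show "a + c \<in> C\<^sub>2" if "a \<in> C\<^sub>2" "c \<in> ?N" for a c using that linear_code_add[OF lin_C\<^sub>2] by simp
    show "B *\<^sub>v a = B *\<^sub>v c \<longleftrightarrow> a - c \<in> ?N" if "a \<in> C\<^sub>2" "c \<in> C\<^sub>2" for a c
      using mult_mat_vec_diff_eq_0_iff[OF B, of a c] linear_code_diff[OF lin_C\<^sub>2 that] that C\<^sub>2_carrier by auto
  qed auto
  moreover have "card {x \<in> \<psi> s. B *\<^sub>v x = y} \<le> card ?N"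
  proof (cases "{x \<in> \<psi> s. B *\<^sub>v x = y} = {}")
    case False
    then obtain x0 where x0: "x0 \<in> \<psi> s" "B *\<^sub>v x0 = y" by blast
    then have x0c: "x0 \<in> carrier_vec n" "s @\<^sub>v x0 \<in> D" using coset_map_iff[OF s] by auto
    have sub: "x - x0 \<in> ?N" if x: "x \<in> \<psi> s" "B *\<^sub>v x = y" for x
    proof -
      have xc: "x \<in> carrier_vec n" "s @\<^sub>v x \<in> D" using coset_map_iff[OF s] x by auto
      have "(s - s) @\<^sub>v (x - x0) \<in> D" using append_diff_in_D xc x0c s by blast
      then have "x - x0 \<in> C\<^sub>2" using C\<^sub>2_iff xc x0c s by simp
      then show ?thesis using mult_mat_vec_diff_eq_0_iff[OF B xc(1) x0c(1)] x x0 by simp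
    qed
    show ?thesis
    proof (rule card_inj_on_le[where f = "\<lambda>x. x - x0"])
      show "inj_on (\<lambda>x. x - x0) {x \<in> \<psi> s. B *\<^sub>v x = y}"
      proof (rule inj_onI)
        fix u v assume "u \<in> {x \<in> \<psi> s. B *\<^sub>v x = y}" "v \<in> {x \<in> \<psi> s. B *\<^sub>v x = y}" and eq: "u - x0 = v - x0"
        then have "u \<in> carrier_vec n" "v \<in> carrier_vec n" using coset_map_iff[OF s] by auto
        then have "u - x0 + x0 = u" "v - x0 + x0 = v" using x0c by auto
        then show "u = v" using eq by metis
      qed
    qed (use sub finite_C\<^sub>2 in auto)
  next
    case True
    show ?thesis by (simp only: True card.empty le0)
  qed
  ultimately show ?thesis by (simp add: mult.commute)
qed

text \<open>If the rows of \<open>B\<close> have rank at least \<open>k - l\<close>, then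
  \<open>B\<close> is injective on \<open>C\<^sub>2\<close> and the at most Q^\<mu> values on
  \<open>C\<^sub>1\<close> suffice. Otherwise independent rows extend to \<open>k - l\<close> forms
  that are bijective on \<open>C\<^sub>2\<close>, and \<open>C\<^sub>1\<close> has no further
  images. Natural subtraction in the exponent is the positive part.\<close>

lemma card_image_le_power:
  assumes B: "B \<in> carrier_mat \<mu> n" "elements_mat B \<subseteq> K"
  shows "card ((*\<^sub>v) B ` C\<^sub>1) \<le> card ((*\<^sub>v) B ` C\<^sub>2) * CARD('a) ^ (\<mu> - (k - l))"
proof -
  let ?R = "set (rows B)"
  have rowsc: "?R \<subseteq> carrier_vec n" using rows_carrier[of B] B(1) by simp
  have rowsK: "?R \<subseteq> vecs_over K n"
  proof
    fix v assume "v \<in> ?R"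
    then obtain i where i: "i < \<mu>" "v = row B i" using B(1) by (auto simp: rows_def)
    have "B $$ (i, j) \<in> K" if "j < n" for j using elements_matI[OF B(1) i(1) that refl] B(2) by blast
    then show "v \<in> vecs_over K n" using i B(1) by (simp add: vecs_over_def)
  qed
  obtain T where T: "T \<subseteq> ?R" "independent_forms n T"
    "\<forall>x\<in>carrier_vec n. (\<forall>v\<in>T. v \<bullet> x = 0) \<longrightarrow> (\<forall>v\<in>?R. v \<bullet> x = 0)"
    using independent_forms_subset[OF _ rowsc] by auto
  have TK: "T \<subseteq> vecs_over K n" and Tc: "T \<subseteq> carrier_vec n" using T(1) rowsK rowsc by auto
  have finT: "finite T" using T(2) by (simp add: independent_forms_def)
  \<comment> \<open>\<open>Teq\<close> and \<open>eqT\<close> together say that \<open>B\<close> and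
    the selected rows \<open>T\<close> have the same fibres, so repeated and dependent rows may be
    dropped.\<close>
  have Teq: "B *\<^sub>v x = B *\<^sub>v y" if "x \<in> carrier_vec n" "y \<in> carrier_vec n" "ev T x = ev T y" for x y
  proof -
    have "\<forall>v\<in>?R. v \<bullet> (x - y) = 0" using T(3) ev_eq_iff[OF Tc that(1,2)] that by auto
    then have "row B i \<bullet> x = row B i \<bullet> y" if "i < \<mu>" for i
      using that B(1) scalar_prod_diff_eq_0_iff[of "row B i" n x y] \<open>x \<in> carrier_vec n\<close> \<open>y \<in> carrier_vec n\<close>
      by (auto simp: rows_def)
    then show ?thesis using B(1) by (intro eq_vecI) auto
  qed
  have eqT: "ev T x = ev T y" if "x \<in> carrier_vec n" "y \<in> carrier_vec n" "B *\<^sub>v x = B *\<^sub>v y" for x y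
  proof -
    have "v \<bullet> x = v \<bullet> y" if "v \<in> T" for v
    proof -
      have "v \<in> ?R" using that T(1) by blast
      then obtain i where "i < \<mu>" "v = row B i" using B(1) by (auto simp: rows_def)
      then show ?thesis using arg_cong[OF \<open>B *\<^sub>v x = B *\<^sub>v y\<close>, of "\<lambda>w. w $ i"] B(1) by simp
    qed
    then show ?thesis by (auto simp: restrict_def)
  qed
  have ev_le: "card (ev T ` A) \<le> CARD('a) ^ card T" for A
  proof -
    have "card (ev T ` A) \<le> card (T \<rightarrow>\<^sub>E (UNIV :: 'a set))"
      using finT by (intro card_mono image_subsetI) (simp_all add: finite_PiE)
    then show ?thesis using finT by (simp add: card_PiE)
  qed
  have one: "CARD('a) ^ j \<ge> 1" for j using order_ge_2 by simp
  show ?thesis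
  proof (cases "k - l \<le> card T")
    case True
    have "inj_on ((*\<^sub>v) B) C\<^sub>2"
    proof (rule inj_onI)
      fix x y assume "x \<in> C\<^sub>2" "y \<in> C\<^sub>2" "B *\<^sub>v x = B *\<^sub>v y"
      then show "x = y" using eqT[of x y] inj_onD[OF inj_on_ev_C\<^sub>2[OF T(2) TK True]] C\<^sub>2_carrier by blast
    qed
    then have c2: "card ((*\<^sub>v) B ` C\<^sub>2) = CARD('a) ^ (k - l)" by (simp add: card_image card_C\<^sub>2)
    have "card T \<le> \<mu>"
      using card_mono[OF _ T(1)] card_length[of "rows B"] B(1) by simp
    have "card ((*\<^sub>v) B ` C\<^sub>1) \<le> card (ev T ` C\<^sub>1)"
      using Teq C\<^sub>1_carrier by (intro card_image_le_card_image finite_C\<^sub>1) blast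
    also have "\<dots> \<le> CARD('a) ^ card T" by (rule ev_le)
    also have "\<dots> \<le> CARD('a) ^ \<mu>" using \<open>card T \<le> \<mu>\<close> order_ge_2 by (intro power_increasing) auto
    also have "\<dots> = CARD('a) ^ (k - l) * CARD('a) ^ (\<mu> - (k - l))"
      using True \<open>card T \<le> \<mu>\<close> by (simp flip: power_add)
    finally show ?thesis unfolding c2 .
  next
    case False
    then have "card T \<le> k - l" by linarith
    moreover have "k - l \<le> n" using k_le by linarith
    ultimately obtain T' where T': "T \<subseteq> T'" "T' \<subseteq> vecs_over K n" "independent_forms n T'" "card T' = k - l"
      using independent_forms_extend[OF T(2) TK subfield_zero[OF K] subfield_one[OF K]] by blast
    have finT': "finite T'" using T'(3) by (simp add: independent_forms_def)
    have "card (ev T' ` C\<^sub>2) = card (T' \<rightarrow>\<^sub>E (UNIV :: 'a set))"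
      using card_image[OF inj_on_ev_C\<^sub>2[OF T'(3,2)]] T'(4) card_C\<^sub>2 finT' by (simp add: card_PiE)
    \<comment> \<open>Injectivity and equal cardinalities give surjectivity, so every word of
      \<open>C\<^sub>1\<close> has the same values under \<open>T'\<close> as some word of
      \<open>C\<^sub>2\<close>.\<close>
    then have surj: "ev T' ` C\<^sub>2 = (T' \<rightarrow>\<^sub>E (UNIV :: 'a set))"
      using finT' by (intro card_subset_eq) (auto intro: finite_PiE)
    have "(*\<^sub>v) B ` C\<^sub>1 \<subseteq> (*\<^sub>v) B ` C\<^sub>2"
    proof (rule image_subsetI)
      fix x assume x: "x \<in> C\<^sub>1"
      have "ev T' x \<in> T' \<rightarrow>\<^sub>E (UNIV :: 'a set)" by simp
      then obtain c where c: "c \<in> C\<^sub>2" "ev T' x = ev T' c" unfolding surj[symmetric] by blast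
      have "ev T x = ev T c"
      proof
        fix v show "ev T x v = ev T c v" using fun_cong[OF c(2), of v] T'(1) by (auto simp: restrict_def split: if_splits)
      qed
      then have "B *\<^sub>v x = B *\<^sub>v c" using Teq x c C\<^sub>1_carrier C\<^sub>2_carrier by blast
      then show "B *\<^sub>v x \<in> (*\<^sub>v) B ` C\<^sub>2" using c(1) by blast
    qed
    then have "card ((*\<^sub>v) B ` C\<^sub>1) \<le> card ((*\<^sub>v) B ` C\<^sub>2)" by (intro card_mono finite_imageI finite_C\<^sub>2)
    also have "\<dots> \<le> card ((*\<^sub>v) B ` C\<^sub>2) * CARD('a) ^ (\<mu> - (k - l))"
      using mult_le_mono2[OF one, of "card ((*\<^sub>v) B ` C\<^sub>2)"] by simp
    finally show ?thesis .
  qed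
qed

text \<open>The rows of \<open>B\<close> are \<open>\<mu>\<close> out of \<open>k\<close> forms that
  separate \<open>C\<^sub>1\<close>. They are constant on a fibre, so the remaining
  \<open>k - \<mu>\<close> forms must separate its points.\<close>

lemma exists_balanced_observation:
  assumes "\<mu> \<le> k"
  shows "\<exists>B\<in>carrier_mat \<mu> n. elements_mat B \<subseteq> K \<and>
    (\<forall>y. card {x \<in> C\<^sub>1. B *\<^sub>v x = y} \<le> CARD('a) ^ (k - \<mu>))"
proof -
  obtain T where T: "independent_forms n T" "T \<subseteq> vecs_over K n" "card T = k"
    using exists_forms[OF k_le] by blast
  then have finT: "finite T" by (simp add: independent_forms_def)
  obtain U where U: "U \<subseteq> T" "card U = \<mu>" "finite U"
    using obtain_subset_with_card_n[of \<mu> T] assms T(3) by auto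
  obtain us where us: "set us = U" "distinct us" using finite_distinct_list[OF U(3)] by blast
  then have len: "length us = \<mu>" using U(2) distinct_card[of us] by simp
  define B where "B = mat_of_rows n us"
  have usK: "set us \<subseteq> vecs_over K n" using us(1) U(1) T(2) by simp
  then have usc: "set us \<subseteq> carrier_vec n" by (auto simp: vecs_over_def)
  have B: "B \<in> carrier_mat \<mu> n" unfolding B_def using mat_of_rows_carrier(1)[of n us] len by simp
  have "elements_mat B \<subseteq> K"
  proof
    fix a assume "a \<in> elements_mat B"
    then obtain i j where ij: "i < \<mu>" "j < n" "a = B $$ (i, j)" using B by auto
    then have "us ! i \<in> vecs_over K n" using usK len nth_mem[of i us] by blast
    then show "a \<in> K" using ij len by (simp add: B_def mat_of_rows_index vecs_over_def)
  qed
  moreover have "card {x \<in> C\<^sub>1. B *\<^sub>v x = y} \<le> CARD('a) ^ (k - \<mu>)" for y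
  proof -
    have "inj_on (ev (T - U)) {x \<in> C\<^sub>1. B *\<^sub>v x = y}"
    proof (rule inj_onI)
      fix x z assume x: "x \<in> {x \<in> C\<^sub>1. B *\<^sub>v x = y}" and z: "z \<in> {x \<in> C\<^sub>1. B *\<^sub>v x = y}"
        and eq: "ev (T - U) x = ev (T - U) z"
      have "v \<bullet> x = v \<bullet> z" if "v \<in> T" for v
      proof (cases "v \<in> U")
        case True
        then obtain i where i: "i < \<mu>" "v = us ! i" using us(1) len by (metis in_set_conv_nth)
        have "us ! i \<in> carrier_vec n" using usc len i(1) nth_mem[of i us] by blast
        then have "row B i = v" unfolding B_def i(2) using i(1) len by (intro mat_of_rows_row) auto
        then have "(B *\<^sub>v w) $ i = v \<bullet> w" for w using i(1) B by simp
        then show ?thesis using x z by (metis (mono_tags, lifting) mem_Collect_eq)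
      next
        case False
        then show ?thesis using fun_cong[OF eq, of v] that by simp
      qed
      then have "ev T x = ev T z" by (auto simp: restrict_def)
      then show "x = z" using inj_onD[OF inj_on_ev_C\<^sub>1[OF T(1,2)]] T(3) x z by simp
    qed
    moreover have "ev (T - U) ` {x \<in> C\<^sub>1. B *\<^sub>v x = y} \<subseteq> ((T - U) \<rightarrow>\<^sub>E (UNIV :: 'a set))"
      using ev_PiE[where T = "T - U"] by blast
    moreover have "finite ((T - U) \<rightarrow>\<^sub>E (UNIV :: 'a set))" using finT by (intro finite_PiE) auto
    ultimately have "card {x \<in> C\<^sub>1. B *\<^sub>v x = y} \<le> card ((T - U) \<rightarrow>\<^sub>E (UNIV :: 'a set))"
      by (rule card_inj_on_le)
    also have "\<dots> = CARD('a) ^ (k - \<mu>)"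
      using finT U T(3) by (simp add: card_PiE card_Diff_subset)
    finally show ?thesis .
  qed
  ultimately show ?thesis using B by blast
qed

end

subsection \<open>Entropy inequalities for finite sums\<close>

text \<open>At most \<open>c\<close> values of \<open>s\<close> are compatible with each
  \<open>y\<close>. The bound follows by summing \<open>ln t \<le> t - 1\<close> with
  \<open>t = pY y / (p s y * c)\<close> over the support.\<close>

lemma sum_entropy_le_log:
  fixes p :: "'s \<Rightarrow> 'y \<Rightarrow> real"
  assumes "finite A" and "finite C" and nn: "\<And>s y. p s y \<ge> 0"
    and total: "(\<Sum>s\<in>A. \<Sum>y\<in>C. p s y) = 1"
    and "b > 1" and "c > 0"
    and fibre: "\<And>y. y \<in> C \<Longrightarrow> real (card {s \<in> A. p s y > 0}) \<le> c"
  defines "pY \<equiv> \<lambda>y. \<Sum>s\<in>A. p s y"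
  shows "- (\<Sum>s\<in>A. \<Sum>y\<in>C. p s y * log b (p s y / pY y)) \<le> log b c"
proof -
  have pY: "p s y \<le> pY y" if "s \<in> A" for s y
    unfolding pY_def using that nn \<open>finite A\<close> by (intro member_le_sum) auto
  \<comment> \<open>The conditional keeps the comparison mass on pairs of positive probability; then
    each \<open>y\<close> is counted at most \<open>c\<close> times.\<close>
  have ptwise: "- (p s y * log b (p s y / pY y))
      \<le> p s y * log b c + ((if p s y > 0 then pY y / c else 0) - p s y) / ln b" if "s \<in> A" for s y
  proof (cases "p s y > 0")
    case True
    then have pos: "pY y > 0" using pY[OF that, of y] by linarith
    have "ln (pY y / (p s y * c)) \<le> pY y / (p s y * c) - 1"
      using True pos \<open>c > 0\<close> by (intro ln_le_minus_one) simp
    then have "p s y * ln (pY y / (p s y * c)) \<le> p s y * (pY y / (p s y * c) - 1)"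
      using True by (intro mult_left_mono) auto
    also have "\<dots> = pY y / c - p s y" using True \<open>c > 0\<close> by (simp add: field_simps)
    also have "ln (pY y / (p s y * c)) = - ln (p s y / pY y) - ln c"
      using True pos \<open>c > 0\<close> by (simp add: ln_div ln_mult)
    finally have "- (p s y * ln (p s y / pY y)) \<le> p s y * ln c + (pY y / c - p s y)"
      by (simp add: algebra_simps)
    then have "- (p s y * ln (p s y / pY y)) / ln b \<le> (p s y * ln c + (pY y / c - p s y)) / ln b"
      using \<open>b > 1\<close> by (intro divide_right_mono) auto
    then show ?thesis using True by (simp add: log_def add_divide_distrib)
  next
    case False
    then show ?thesis using nn[of s y] by simp
  qed
  have total': "(\<Sum>y\<in>C. pY y) = 1" unfolding pY_def using total by (subst sum.swap)
  have pY_nn: "pY y \<ge> 0" for y unfolding pY_def by (simp add: nn sum_nonneg)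
  have "(\<Sum>s\<in>A. \<Sum>y\<in>C. (if p s y > 0 then pY y / c else 0))
      = (\<Sum>y\<in>C. real (card {s \<in> A. p s y > 0}) * (pY y / c))"
    using \<open>finite A\<close> by (subst sum.swap) (simp add: sum.If_cases Int_def)
  also have "\<dots> \<le> (\<Sum>y\<in>C. c * (pY y / c))"
    using fibre pY_nn \<open>c > 0\<close> by (intro sum_mono mult_right_mono) auto
  also have "\<dots> = 1" using \<open>c > 0\<close> total' by simp
  finally have le1: "(\<Sum>s\<in>A. \<Sum>y\<in>C. (if p s y > 0 then pY y / c else 0)) \<le> 1" .
  have "- (\<Sum>s\<in>A. \<Sum>y\<in>C. p s y * log b (p s y / pY y))
      = (\<Sum>s\<in>A. \<Sum>y\<in>C. - (p s y * log b (p s y / pY y)))" by (simp add: sum_negf)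
  also have "\<dots> \<le> (\<Sum>s\<in>A. \<Sum>y\<in>C. p s y * log b c + ((if p s y > 0 then pY y / c else 0) - p s y) / ln b)"
    by (intro sum_mono ptwise)
  also have "\<dots> = log b c + ((\<Sum>s\<in>A. \<Sum>y\<in>C. (if p s y > 0 then pY y / c else 0)) - 1) / ln b"
    by (simp add: sum.distrib sum_subtractf total flip: sum_distrib_right sum_divide_distrib)
  also have "\<dots> \<le> log b c" using le1 \<open>b > 1\<close> by (simp add: divide_nonpos_pos)
  finally show ?thesis .
qed

text \<open>In entropy terms, with \<open>Y = f(X)\<close>: the subtracted divergence is
  \<open>log d - H(X|S)\<close>, the fibre bound gives \<open>H(X|S,Y) \<le> log c\<close>, and
  \<open>H(Y) \<le> log |Z|\<close>. These estimates are merged into one use of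
  \<open>ln t \<le> t - 1\<close>.\<close>

lemma sum_entropy_ge:
  fixes p :: "'s \<Rightarrow> 'x \<Rightarrow> real" and f :: "'x \<Rightarrow> 'y"
  assumes "finite A" and "finite C" and "finite Y" and fY: "f ` C \<subseteq> Y"
    and nn: "\<And>s x. p s x \<ge> 0"
    and total: "(\<Sum>s\<in>A. \<Sum>x\<in>C. p s x) = 1"
    and "b > 1" and "c > 0" and "d > 0"
    and Z: "\<And>s x. s \<in> A \<Longrightarrow> x \<in> C \<Longrightarrow> p s x > 0 \<Longrightarrow> f x \<in> Z" "finite Z" "Z \<noteq> {}"
    and fibre: "\<And>s y. s \<in> A \<Longrightarrow> real (card {x \<in> C. f x = y \<and> p s x > 0}) \<le> c"
  defines "pS \<equiv> \<lambda>s. \<Sum>x\<in>C. p s x"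
    and "pSY \<equiv> \<lambda>s y. \<Sum>x\<in>{x \<in> C. f x = y}. p s x"
    and "pY \<equiv> \<lambda>y. \<Sum>s\<in>A. \<Sum>x\<in>{x \<in> C. f x = y}. p s x"
  shows "- (\<Sum>s\<in>A. pS s * log b (pS s)) - (\<Sum>s\<in>A. \<Sum>x\<in>C. p s x * log b (p s x / pS s * d))
     - log b (real (card Z) * c / d) \<le> - (\<Sum>s\<in>A. \<Sum>y\<in>Y. pSY s y * log b (pSY s y / pY y))"
proof -
  let ?z = "real (card Z)"
  have z: "?z > 0" using Z by (simp add: card_gt_0_iff)
  have pS: "p s x \<le> pS s" if "x \<in> C" for s x
    unfolding pS_def using that nn \<open>finite C\<close> by (intro member_le_sum) auto
  have pSY: "p s x \<le> pSY s (f x)" if "x \<in> C" for s x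
    unfolding pSY_def using that nn \<open>finite C\<close> by (intro member_le_sum) auto
  have pSY_nn: "pSY s y \<ge> 0" for s y unfolding pSY_def by (simp add: nn sum_nonneg)
  have pY_eq: "pY y = (\<Sum>s\<in>A. pSY s y)" for y unfolding pY_def pSY_def ..
  have pY: "pSY s y \<le> pY y" if "s \<in> A" for s y
    unfolding pY_eq using that pSY_nn \<open>finite A\<close> by (intro member_le_sum) auto
  \<comment> \<open>On the support this is \<open>p s x\<close> times the ratio \<open>?r\<close>
    used below; the estimate rests on its total being at most 1.\<close>
  define g where "g s x = (if p s x > 0 then pSY s (f x) / (pY (f x) * ?z * c) else 0)" for s x
  have ptwise: "- (p s x * log b (pS s)) - p s x * log b (p s x / pS s * d) - p s x * log b (?z * c / d)
      \<le> - (p s x * log b (pSY s (f x) / pY (f x))) + (g s x - p s x) / ln b"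
    if "s \<in> A" "x \<in> C" for s x
  proof (cases "p s x > 0")
    case True
    have pos: "pS s > 0" "pSY s (f x) > 0" "pY (f x) > 0"
      using True pS[OF that(2), of s] pSY[OF that(2), of s] pY[OF that(1), of "f x"] by linarith+
    \<comment> \<open>Chosen so that its logarithm splits into the four logarithms of the pointwise
      claim.\<close>
    let ?r = "pSY s (f x) / (p s x * pY (f x) * ?z * c)"
    have r: "?r > 0" using True pos z \<open>c > 0\<close> by simp
    have "p s x * ln ?r \<le> p s x * (?r - 1)"
      using True ln_le_minus_one[OF r] by (intro mult_left_mono) auto
    also have "\<dots> = g s x - p s x" using True \<open>c > 0\<close> z pos by (simp add: g_def field_simps)
    also have "ln ?r = ln (pSY s (f x) / pY (f x)) - ln (pS s) - ln (p s x / pS s * d) - ln (?z * c / d)"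
      using True pos z \<open>c > 0\<close> \<open>d > 0\<close> by (simp add: ln_div ln_mult)
    finally have "- (p s x * ln (pS s)) - p s x * ln (p s x / pS s * d) - p s x * ln (?z * c / d)
        \<le> - (p s x * ln (pSY s (f x) / pY (f x))) + (g s x - p s x)"
      by (simp add: algebra_simps)
    then have "(- (p s x * ln (pS s)) - p s x * ln (p s x / pS s * d) - p s x * ln (?z * c / d)) / ln b
        \<le> (- (p s x * ln (pSY s (f x) / pY (f x))) + (g s x - p s x)) / ln b"
      using \<open>b > 1\<close> by (intro divide_right_mono) auto
    then show ?thesis by (simp add: log_def add_divide_distrib diff_divide_distrib)
  next
    case False
    then show ?thesis using nn[of s x] by (simp add: g_def)
  qed
  have "(\<Sum>s\<in>A. \<Sum>x\<in>C. g s x) \<le> (\<Sum>s\<in>A. \<Sum>y\<in>Z. pSY s y / (pY y * ?z))"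
  proof (rule sum_mono)
    fix s assume s: "s \<in> A"
    have "(\<Sum>x\<in>C. g s x) = (\<Sum>x\<in>{x \<in> C. p s x > 0}. g s x)"
      using \<open>finite C\<close> by (intro sum.mono_neutral_right) (auto simp: g_def)
    also have "\<dots> = (\<Sum>y\<in>Z. \<Sum>x\<in>{x \<in> {x \<in> C. p s x > 0}. f x = y}. g s x)"
      using Z(1,2) s \<open>finite C\<close> by (intro sum.group[symmetric]) auto
    also have "\<dots> \<le> (\<Sum>y\<in>Z. pSY s y / (pY y * ?z))"
    proof (rule sum_mono)
      fix y assume "y \<in> Z"
      have q: "0 \<le> pSY s y / (pY y * ?z * c)"
        using pSY_nn[of s y] pY[OF s, of y] \<open>c > 0\<close> z by simp
      have "(\<Sum>x\<in>{x \<in> {x \<in> C. p s x > 0}. f x = y}. g s x)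
          = (\<Sum>x\<in>{x \<in> C. f x = y \<and> p s x > 0}. pSY s y / (pY y * ?z * c))"
        by (intro sum.cong) (auto simp: g_def)
      also have "\<dots> \<le> c * (pSY s y / (pY y * ?z * c))"
        using mult_right_mono[OF fibre[OF s, of y] q] by simp
      also have "\<dots> = pSY s y / (pY y * ?z)" using \<open>c > 0\<close> by simp
      finally show "(\<Sum>x\<in>{x \<in> {x \<in> C. p s x > 0}. f x = y}. g s x) \<le> pSY s y / (pY y * ?z)" .
    qed
    finally show "(\<Sum>x\<in>C. g s x) \<le> (\<Sum>y\<in>Z. pSY s y / (pY y * ?z))" .
  qed
  also have "\<dots> = (\<Sum>y\<in>Z. pY y / (pY y * ?z))"
    by (subst sum.swap) (simp add: pY_eq sum_divide_distrib)
  \<comment> \<open>Only an inequality, because \<open>pY y\<close> may vanish and the quotient is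
    then 0.\<close>
  also have "\<dots> \<le> (\<Sum>y\<in>Z. 1 / ?z)"
    using z by (intro sum_mono) auto
  also have "\<dots> = 1" using z by simp
  finally have g_le: "(\<Sum>s\<in>A. \<Sum>x\<in>C. g s x) \<le> 1" .
  have group: "(\<Sum>y\<in>Y. pSY s y * log b (pSY s y / pY y)) = (\<Sum>x\<in>C. p s x * log b (pSY s (f x) / pY (f x)))" for s
  proof -
    have "(\<Sum>x\<in>C. p s x * log b (pSY s (f x) / pY (f x)))
        = (\<Sum>y\<in>Y. \<Sum>x\<in>{x \<in> C. f x = y}. p s x * log b (pSY s (f x) / pY (f x)))"
      using fY \<open>finite C\<close> \<open>finite Y\<close> by (intro sum.group[symmetric]) auto
    also have "\<dots> = (\<Sum>y\<in>Y. \<Sum>x\<in>{x \<in> C. f x = y}. p s x * log b (pSY s y / pY y))"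
      by (intro sum.cong) auto
    finally show ?thesis by (simp add: pSY_def sum_distrib_right)
  qed
  have "- (\<Sum>s\<in>A. pS s * log b (pS s)) - (\<Sum>s\<in>A. \<Sum>x\<in>C. p s x * log b (p s x / pS s * d))
     - log b (?z * c / d)
     = (\<Sum>s\<in>A. \<Sum>x\<in>C. - (p s x * log b (pS s)) - p s x * log b (p s x / pS s * d) - p s x * log b (?z * c / d))"
    by (simp add: sum_subtractf sum_negf total flip: sum_distrib_right) (simp add: pS_def)
  also have "\<dots> \<le> (\<Sum>s\<in>A. \<Sum>x\<in>C. - (p s x * log b (pSY s (f x) / pY (f x))) + (g s x - p s x) / ln b)"
    by (intro sum_mono ptwise)
  also have "\<dots> = - (\<Sum>s\<in>A. \<Sum>y\<in>Y. pSY s y * log b (pSY s y / pY y)) + ((\<Sum>s\<in>A. \<Sum>x\<in>C. g s x) - 1) / ln b"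
    by (simp add: group sum.distrib sum_subtractf sum_negf total flip: sum_divide_distrib)
  also have "\<dots> \<le> - (\<Sum>s\<in>A. \<Sum>y\<in>Y. pSY s y * log b (pSY s y / pY y))"
    using g_le \<open>b > 1\<close> by (simp add: divide_nonpos_pos)
  finally show ?thesis .
qed

subsection \<open>Entropies of finitely valued random variables\<close>

lemma simple_function_count_space:
  assumes "Y \<in> measurable M (count_space A)" and "finite A"
  shows "simple_function M Y"
  unfolding simple_function_def
proof (intro conjI ballI)
  have im: "Y ` space M \<subseteq> A" using measurable_space[OF assms(1)] by auto
  then show "finite (Y ` space M)" using \<open>finite A\<close> finite_subset by blast
  fix y assume "y \<in> Y ` space M"
  then show "Y -` {y} \<inter> space M \<in> sets M" using im by (intro measurable_sets[OF assms(1)]) auto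
qed

context prob_space
begin

abbreviation joint_prob :: "('a \<Rightarrow> 's) \<Rightarrow> ('a \<Rightarrow> 'x) \<Rightarrow> 's \<Rightarrow> 'x \<Rightarrow> real" where
  "joint_prob S X s x \<equiv> prob (S -` {s} \<inter> X -` {x} \<inter> space M)"

section \<open>Joint and marginal probabilities\<close>

lemma count_space_events:
  assumes "X \<in> measurable M (count_space C)"
  shows "X -` {x} \<inter> space M \<in> events"
proof (cases "x \<in> C")
  case True
  then show ?thesis by (intro measurable_sets[OF assms]) auto
next
  case False
  then have "X -` {x} \<inter> space M = {}" using measurable_space[OF assms] by auto
  then show ?thesis by simp
qed

lemma joint_events:
  assumes "S \<in> measurable M (count_space A)" and "X \<in> measurable M (count_space C)"
  shows "S -` {s} \<inter> X -` {x} \<inter> space M \<in> events"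
proof -
  have "S -` {s} \<inter> X -` {x} \<inter> space M = (S -` {s} \<inter> space M) \<inter> (X -` {x} \<inter> space M)" by auto
  then show ?thesis using count_space_events assms by (metis sets.Int)
qed

text \<open>Finite additivity over the fibres of \<open>X\<close>. The free event \<open>E\<close>
  and predicate \<open>P\<close> let one formula yield marginals, laws of functions of
  \<open>X\<close>, and the total mass.\<close>

lemma prob_eq_sum_fibres:
  assumes X: "X \<in> measurable M (count_space C)" and "finite C" and E: "E \<in> events"
  shows "prob {\<omega> \<in> E. P (X \<omega>)} = (\<Sum>x\<in>{x \<in> C. P x}. prob (E \<inter> X -` {x}))"
proof -
  have E_sub: "E \<subseteq> space M" using E sets.sets_into_space by blast
  have ev: "E \<inter> X -` {x} \<in> events" for x
  proof -
    have "E \<inter> X -` {x} = E \<inter> (X -` {x} \<inter> space M)" using E_sub by auto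
    then show ?thesis using count_space_events[OF X] E by (metis sets.Int)
  qed
  have "{\<omega> \<in> E. P (X \<omega>)} = (\<Union>x\<in>{x \<in> C. P x}. E \<inter> X -` {x})"
    using E_sub measurable_space[OF X] by auto
  moreover have "prob (\<Union>x\<in>{x \<in> C. P x}. E \<inter> X -` {x}) = (\<Sum>x\<in>{x \<in> C. P x}. prob (E \<inter> X -` {x}))"
    using \<open>finite C\<close> ev by (intro finite_measure_finite_Union) (auto simp: disjoint_family_on_def)
  ultimately show ?thesis by simp
qed

lemma joint_prob_map:
  assumes "S \<in> measurable M (count_space A)" and X: "X \<in> measurable M (count_space C)" and "finite C"
  shows "joint_prob S (\<lambda>\<omega>. f (X \<omega>)) s y = (\<Sum>x\<in>{x \<in> C. f x = y}. joint_prob S X s x)"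
proof -
  have "S -` {s} \<inter> (\<lambda>\<omega>. f (X \<omega>)) -` {y} \<inter> space M = {\<omega> \<in> S -` {s} \<inter> space M. f (X \<omega>) = y}" by auto
  moreover have "S -` {s} \<inter> X -` {x} \<inter> space M = (S -` {s} \<inter> space M) \<inter> X -` {x}" for x by auto
  ultimately show ?thesis
    using prob_eq_sum_fibres[OF X \<open>finite C\<close> count_space_events[OF assms(1), of s], where P = "\<lambda>x. f x = y"] by simp
qed

lemma prob_eq_sum_joint:
  assumes "S \<in> measurable M (count_space A)" and X: "X \<in> measurable M (count_space C)" and "finite C"
  shows "prob (S -` {s} \<inter> space M) = (\<Sum>x\<in>C. joint_prob S X s x)"
  \<comment> \<open>A constant observation turns the joint probability into the marginal of
    \<open>S\<close>.\<close>
  using joint_prob_map[OF assms, where f = "\<lambda>_. ()" and s = s and y = "()"] by (simp add: vimage_def)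

lemma joint_prob_commute: "joint_prob S X s x = joint_prob X S x s"
  by (simp add: Int_ac)

lemma prob_eq_sum_joint_right:
  assumes "S \<in> measurable M (count_space A)" "finite A" and "Y \<in> measurable M (count_space C)"
  shows "prob (Y -` {y} \<inter> space M) = (\<Sum>s\<in>A. joint_prob S Y s y)"
  unfolding prob_eq_sum_joint[OF assms(3,1,2)] by (intro sum.cong refl joint_prob_commute)

lemma sum_joint_prob:
  assumes S: "S \<in> measurable M (count_space A)" "finite A" and X: "X \<in> measurable M (count_space C)" "finite C"
  shows "(\<Sum>s\<in>A. \<Sum>x\<in>C. joint_prob S X s x) = 1"
proof -
  have "prob {\<omega> \<in> space M. True} = (\<Sum>s\<in>{s \<in> A. True}. prob (space M \<inter> S -` {s}))"
    by (rule prob_eq_sum_fibres[OF S sets.top, where P = "\<lambda>_. True"])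
  then show ?thesis using prob_eq_sum_joint[OF S(1) X] prob_space by (simp add: Int_commute)
qed

section \<open>Divergence from a uniform law\<close>

lemma uniform_measure_count_space:
  assumes "finite C" and "A \<subseteq> C"
  shows "uniform_measure (count_space C) A = density (count_space C) (\<lambda>x. ennreal (indicat_real A x / real (card A)))"
proof (cases "A = {}")
  case False
  then have "card A > 0" using assms finite_subset by (simp add: card_gt_0_iff)
  moreover have "emeasure (count_space C) A = ennreal (real (card A))"
    using assms finite_subset[OF assms(2,1)] by (simp add: ennreal_of_nat_eq_real_of_nat)
  ultimately show ?thesis
    unfolding uniform_measure_def
    by (intro density_cong) (auto simp: indicator_def divide_ennreal simp flip: ennreal_1)
qed (simp add: uniform_measure_def)

text \<open>Given \<open>E\<close>, the variable \<open>X\<close> has no mass outside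
  \<open>A\<close>, so its conditional law has density \<open>r x * card A\<close> with respect to
  the uniform law on \<open>A\<close>. The divergence is then the integral of \<open>t log t\<close>
  for this density, a finite sum.\<close>

lemma KL_divergence_uniform:
  assumes E: "E \<in> events" "prob E > 0" and X: "X \<in> measurable M (count_space C)" and "finite C"
    and A: "A \<subseteq> C" "A \<noteq> {}" and supp: "\<And>x. x \<in> C \<Longrightarrow> x \<notin> A \<Longrightarrow> prob (E \<inter> X -` {x}) = 0" and "b > 1"
  defines "Q \<equiv> uniform_measure (count_space C) A"
  shows "KL_divergence b Q (distr (uniform_measure M E) Q X) =
    (\<Sum>x\<in>C. prob (E \<inter> X -` {x}) / prob E * log b (prob (E \<inter> X -` {x}) / prob E * real (card A)))"
proof -
  define r where "r x = prob (E \<inter> X -` {x}) / prob E" for x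
  have r_nn: "r x \<ge> 0" for x by (simp add: r_def)
  have finA: "finite A" using A \<open>finite C\<close> finite_subset by blast
  have cA: "card A > 0" using A finA by (simp add: card_gt_0_iff)
  have Q: "Q = density (count_space C) (\<lambda>x. ennreal (indicat_real A x / real (card A)))"
    unfolding Q_def by (rule uniform_measure_count_space[OF \<open>finite C\<close> A(1)])
  have sQ: "sets Q = Pow C" "space Q = C" by (simp_all add: Q_def)
  have E_sub: "E \<subseteq> space M" using E sets.sets_into_space by blast
  have XQ: "X \<in> measurable (uniform_measure M E) Q"
    using X by (simp add: Q_def measurable_cong_sets[OF sets_uniform_measure sets_uniform_measure])
  interpret Q: prob_space Q
    unfolding Q_def using A finA cA by (intro prob_space_uniform_measure) auto
  have dens: "distr (uniform_measure M E) Q X = density Q (\<lambda>x. ennreal (r x * real (card A)))"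
  proof (rule measure_eqI_finite)
    show "sets (distr (uniform_measure M E) Q X) = Pow C"
      "sets (density Q (\<lambda>x. ennreal (r x * real (card A)))) = Pow C" by (simp_all add: sQ)
    show "finite C" by fact
    fix x assume x: "x \<in> C"
    have "emeasure (distr (uniform_measure M E) Q X) {x}
        = emeasure (uniform_measure M E) (X -` {x} \<inter> space M)"
      using XQ x by (subst emeasure_distr) (auto simp: sQ)
    also have "\<dots> = emeasure M (E \<inter> (X -` {x} \<inter> space M)) / emeasure M E"
      using E count_space_events[OF X] by (subst emeasure_uniform_measure) auto
    also have "E \<inter> (X -` {x} \<inter> space M) = E \<inter> X -` {x}" using E_sub by auto
    also have "emeasure M (E \<inter> X -` {x}) / emeasure M E = ennreal (r x)"
      using E by (simp add: emeasure_eq_measure r_def divide_ennreal)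
    finally have l: "emeasure (distr (uniform_measure M E) Q X) {x} = ennreal (r x)" .
    have "density Q (\<lambda>x. ennreal (r x * real (card A)))
        = density (count_space C) (\<lambda>x. ennreal (indicat_real A x / real (card A)) * ennreal (r x * real (card A)))"
      unfolding Q by (subst density_density_eq) auto
    also have "emeasure \<dots> {x} = (\<integral>\<^sup>+ y. ennreal (indicat_real A y / real (card A)) * ennreal (r y * real (card A)) * indicator {x} y \<partial>count_space C)"
      using x by (intro emeasure_density) auto
    also have "\<dots> = (\<Sum>y\<in>C. ennreal (indicat_real A y / real (card A)) * ennreal (r y * real (card A)) * indicator {x} y)"
      by (rule nn_integral_count_space_finite[OF \<open>finite C\<close>])
    also have "\<dots> = (\<Sum>y\<in>C. if y = x then ennreal (indicat_real A y / real (card A)) * ennreal (r y * real (card A)) else 0)"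
      by (intro sum.cong) auto
    also have "\<dots> = ennreal (indicat_real A x / real (card A)) * ennreal (r x * real (card A))"
      using x \<open>finite C\<close> by simp
    also have "\<dots> = ennreal (r x)"
      using cA supp[OF x] r_nn by (auto simp: indicator_def r_def simp flip: ennreal_mult')
    finally show "emeasure (distr (uniform_measure M E) Q X) {x} =
      emeasure (density Q (\<lambda>x. ennreal (r x * real (card A)))) {x}" using l by simp
  qed
  have meas: "f \<in> borel_measurable Q" for f :: "_ \<Rightarrow> real"
    unfolding Q_def by (simp add: measurable_cong_sets[OF sets_uniform_measure refl])
  have "KL_divergence b Q (distr (uniform_measure M E) Q X)
      = (\<integral>x. (r x * real (card A)) * log b (r x * real (card A)) \<partial>Q)"
    unfolding dens using \<open>b > 1\<close> r_nn meas by (intro Q.KL_density) auto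
  also have "\<dots> = (\<integral>x. (indicat_real A x / real (card A)) *\<^sub>R ((r x * real (card A)) * log b (r x * real (card A))) \<partial>count_space C)"
    unfolding Q by (subst integral_density) auto
  also have "\<dots> = (\<Sum>x\<in>C. (indicat_real A x / real (card A)) * ((r x * real (card A)) * log b (r x * real (card A))))"
    using \<open>finite C\<close> by (simp add: lebesgue_integral_count_space_finite)
  \<comment> \<open>Outside \<open>A\<close> the indicator kills the left summand and
    \<open>r x = 0\<close> kills the right one.\<close>
  also have "\<dots> = (\<Sum>x\<in>C. r x * log b (r x * real (card A)))"
    using cA supp by (intro sum.cong) (auto simp: indicator_def r_def)
  finally show ?thesis by (simp add: r_def)
qed

lemma conditional_divergence_uniform:
  assumes S: "S \<in> measurable M (count_space A)" "finite A" and X: "X \<in> measurable M (count_space C)" "finite C"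
    and U: "\<And>s. s \<in> A \<Longrightarrow> U s \<subseteq> C" "\<And>s. s \<in> A \<Longrightarrow> card (U s) = d" "d > 0"
    and supp: "\<And>s x. s \<in> A \<Longrightarrow> x \<in> C \<Longrightarrow> x \<notin> U s \<Longrightarrow> joint_prob S X s x = 0" and "b > 1"
  shows "conditional_divergence b S X (\<lambda>s. uniform_measure (count_space C) (U s)) =
    (\<Sum>s\<in>A. \<Sum>x\<in>C. joint_prob S X s x * log b (joint_prob S X s x / prob (S -` {s} \<inter> space M) * real d))"
proof -
  have im: "S ` space M \<subseteq> A" using measurable_space[OF S(1)] by auto
  have eq: "S -` {s} \<inter> space M \<inter> X -` {x} = S -` {s} \<inter> X -` {x} \<inter> space M" for s x by auto
  have "prob (S -` {s} \<inter> space M) * KL_divergence b (uniform_measure (count_space C) (U s))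
      (distr (uniform_measure M (S -` {s} \<inter> space M)) (uniform_measure (count_space C) (U s)) X)
    = (\<Sum>x\<in>C. joint_prob S X s x * log b (joint_prob S X s x / prob (S -` {s} \<inter> space M) * real d))"
    if s: "s \<in> A" for s
  proof (cases "prob (S -` {s} \<inter> space M) > 0")
    case True
    have "U s \<noteq> {}" using U(2)[OF s] U(3) by auto
    have "KL_divergence b (uniform_measure (count_space C) (U s))
        (distr (uniform_measure M (S -` {s} \<inter> space M)) (uniform_measure (count_space C) (U s)) X)
      = (\<Sum>x\<in>C. joint_prob S X s x / prob (S -` {s} \<inter> space M)
          * log b (joint_prob S X s x / prob (S -` {s} \<inter> space M) * real d))"
      using KL_divergence_uniform[OF count_space_events[OF S(1)] True X U(1)[OF s] \<open>U s \<noteq> {}\<close> _ \<open>b > 1\<close>]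
        supp[OF s] U(2)[OF s] by (simp add: eq)
    then show ?thesis using True by (simp add: sum_distrib_left)
  next
    \<comment> \<open>Conditioning on a null value says nothing about \<open>X\<close>, but its
      divergence has weight 0 and all its joint probabilities vanish.\<close>
    case False
    then have "prob (S -` {s} \<inter> space M) = 0" using measure_nonneg[of M] by (simp add: not_less antisym)
    moreover have "joint_prob S X s x \<le> prob (S -` {s} \<inter> space M)" for x
      using count_space_events[OF S(1)] by (intro finite_measure_mono) auto
    ultimately have "joint_prob S X s x = 0" for x by (metis measure_le_0_iff)
    then show ?thesis using \<open>prob (S -` {s} \<inter> space M) = 0\<close> by simp
  qed
  moreover have "conditional_divergence b S X (\<lambda>s. uniform_measure (count_space C) (U s))
    = (\<Sum>s\<in>A. prob (S -` {s} \<inter> space M) * KL_divergence b (uniform_measure (count_space C) (U s))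
      (distr (uniform_measure M (S -` {s} \<inter> space M)) (uniform_measure (count_space C) (U s)) X))"
    unfolding conditional_divergence_def
  \<comment> \<open>Values in \<open>A\<close> that are never attained have empty preimage, so
    enlarging the index set adds only zeros.\<close>
  proof (rule sum.mono_neutral_left[OF \<open>finite A\<close> im], intro ballI)
    fix s assume "s \<in> A - S ` space M"
    then have "S -` {s} \<inter> space M = {}" by auto
    then show "prob (S -` {s} \<inter> space M) * KL_divergence b (uniform_measure (count_space C) (U s))
      (distr (uniform_measure M (S -` {s} \<inter> space M)) (uniform_measure (count_space C) (U s)) X) = 0" by simp
  qed
  ultimately show ?thesis by simp
qed

end

context information_space
begin

section \<open>Entropies as finite sums and their bounds\<close>

lemma discrete_entropy_eq_sum:
  assumes S: "S \<in> measurable M (count_space A)" "finite A"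
  shows "discrete_entropy b S = - (\<Sum>s\<in>A. prob (S -` {s} \<inter> space M) * log b (prob (S -` {s} \<inter> space M)))"
proof -
  have im: "S ` space M \<subseteq> A" using measurable_space[OF S(1)] by auto
  have "discrete_entropy b S = - (\<Sum>s\<in>S ` space M. prob (S -` {s} \<inter> space M) * log b (prob (S -` {s} \<inter> space M)))"
    unfolding discrete_entropy_def
    by (rule entropy_simple_distributed[OF simple_distributedI[OF simple_function_count_space[OF S] measure_nonneg refl]])
  moreover have "(\<Sum>s\<in>S ` space M. prob (S -` {s} \<inter> space M) * log b (prob (S -` {s} \<inter> space M)))
      = (\<Sum>s\<in>A. prob (S -` {s} \<inter> space M) * log b (prob (S -` {s} \<inter> space M)))"
  proof (rule sum.mono_neutral_left[OF \<open>finite A\<close> im], intro ballI)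
    fix s assume "s \<in> A - S ` space M"
    then have "S -` {s} \<inter> space M = {}" by auto
    then show "prob (S -` {s} \<inter> space M) * log b (prob (S -` {s} \<inter> space M)) = 0" by simp
  qed
  ultimately show ?thesis by simp
qed

lemma discrete_cond_entropy_eq_sum:
  assumes S: "S \<in> measurable M (count_space A)" "finite A" and Y: "Y \<in> measurable M (count_space C)" "finite C"
  shows "discrete_cond_entropy b S Y =
    - (\<Sum>s\<in>A. \<Sum>y\<in>C. joint_prob S Y s y * log b (joint_prob S Y s y / prob (Y -` {y} \<inter> space M)))"
proof -
  let ?SY = "\<lambda>\<omega>. (S \<omega>, Y \<omega>)"
  note sf = simple_function_count_space[OF S] simple_function_count_space[OF Y]
  have pre: "?SY -` {(s, y)} \<inter> space M = S -` {s} \<inter> Y -` {y} \<inter> space M" for s y by auto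
  have im: "?SY ` space M \<subseteq> A \<times> C" using measurable_space[OF S(1)] measurable_space[OF Y(1)] by auto
  have "discrete_cond_entropy b S Y = - (\<Sum>(s, y)\<in>?SY ` space M.
      prob (?SY -` {(s, y)} \<inter> space M) * log b (prob (?SY -` {(s, y)} \<inter> space M) / prob (Y -` {y} \<inter> space M)))"
    unfolding discrete_cond_entropy_def
    by (rule conditional_entropy_eq[OF simple_distributedI[OF sf(2) measure_nonneg refl]
        simple_distributedI[OF simple_function_Pair[OF sf] measure_nonneg refl]])
  also have "(\<Sum>(s, y)\<in>?SY ` space M.
      prob (?SY -` {(s, y)} \<inter> space M) * log b (prob (?SY -` {(s, y)} \<inter> space M) / prob (Y -` {y} \<inter> space M)))
    = (\<Sum>(s, y)\<in>A \<times> C. joint_prob S Y s y * log b (joint_prob S Y s y / prob (Y -` {y} \<inter> space M)))"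
    unfolding pre
  proof (rule sum.mono_neutral_left[OF finite_cartesian_product[OF S(2) Y(2)] im], intro ballI)
    fix z assume z: "z \<in> A \<times> C - ?SY ` space M"
    obtain s y where sy: "z = (s, y)" by (cases z)
    then have "S -` {s} \<inter> Y -` {y} \<inter> space M = {}" using z by auto
    then show "(case z of (s, y) \<Rightarrow> joint_prob S Y s y * log b (joint_prob S Y s y / prob (Y -` {y} \<inter> space M))) = 0"
      unfolding sy by simp
  qed
  finally show ?thesis by (simp add: sum.cartesian_product)
qed

lemma discrete_cond_entropy_le:
  assumes S: "S \<in> measurable M (count_space A)" "finite A" and Y: "Y \<in> measurable M (count_space C)" "finite C"
    and "c > 0" and fibre: "\<And>y. y \<in> C \<Longrightarrow> real (card {s \<in> A. joint_prob S Y s y > 0}) \<le> c"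
  shows "discrete_cond_entropy b S Y \<le> log b c"
proof -
  show ?thesis
    unfolding discrete_cond_entropy_eq_sum[OF S Y] prob_eq_sum_joint_right[OF S Y(1)]
    by (rule sum_entropy_le_log[OF S(2) Y(2) measure_nonneg sum_joint_prob[OF S Y] b_gt_1 \<open>c > 0\<close> fibre])
qed

text \<open>Carries \<open>sum_entropy_ge\<close> over to random variables: as \<open>X\<close>
  stays in \<open>U s\<close> given \<open>S = s\<close>, counts inside \<open>U s\<close> bound the
  number of points of positive probability, and their observations lie in \<open>Z\<close>.\<close>

lemma discrete_cond_entropy_ge:
  assumes S: "S \<in> measurable M (count_space A)" "finite A" and X: "X \<in> measurable M (count_space C)" "finite C"
    and f: "f ` C \<subseteq> Y" "finite Y"
    and U: "\<And>s. s \<in> A \<Longrightarrow> U s \<subseteq> C" "\<And>s. s \<in> A \<Longrightarrow> card (U s) = d" "d > 0"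
    and supp: "\<And>s x. s \<in> A \<Longrightarrow> x \<in> C \<Longrightarrow> x \<notin> U s \<Longrightarrow> joint_prob S X s x = 0"
    and Z: "\<And>s. s \<in> A \<Longrightarrow> f ` U s \<subseteq> Z" "finite Z" "Z \<noteq> {}"
    and "c > 0" and fibre: "\<And>s y. s \<in> A \<Longrightarrow> real (card {x \<in> U s. f x = y}) \<le> c"
  shows "discrete_entropy b S - conditional_divergence b S X (\<lambda>s. uniform_measure (count_space C) (U s))
      - log b (real (card Z) * c / real d) \<le> discrete_cond_entropy b S (\<lambda>\<omega>. f (X \<omega>))"
proof -
  have Y: "(\<lambda>\<omega>. f (X \<omega>)) \<in> measurable M (count_space Y)"
    using f(1) by (intro measurable_compose[OF X(1)]) auto
  have pY: "prob ((\<lambda>\<omega>. f (X \<omega>)) -` {y} \<inter> space M) = (\<Sum>s\<in>A. \<Sum>x\<in>{x \<in> C. f x = y}. joint_prob S X s x)" for y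
    unfolding prob_eq_sum_joint_right[OF S Y] joint_prob_map[OF S(1) X, where f = f] ..
  have supp': "x \<in> U s" if "s \<in> A" "x \<in> C" "joint_prob S X s x > 0" for s x
    using supp[OF that(1,2)] that(3) by fastforce
  have fibre': "real (card {x \<in> C. f x = y \<and> joint_prob S X s x > 0}) \<le> c" if s: "s \<in> A" for s y
  proof -
    have "finite (U s)" using U(1)[OF s] X(2) finite_subset by blast
    then have "card {x \<in> C. f x = y \<and> joint_prob S X s x > 0} \<le> card {x \<in> U s. f x = y}"
      using supp'[OF s] by (intro card_mono) auto
    then show ?thesis using fibre[OF s, of y] by linarith
  qed
  have "- (\<Sum>s\<in>A. (\<Sum>x\<in>C. joint_prob S X s x) * log b (\<Sum>x\<in>C. joint_prob S X s x))
      - (\<Sum>s\<in>A. \<Sum>x\<in>C. joint_prob S X s x * log b (joint_prob S X s x / (\<Sum>x\<in>C. joint_prob S X s x) * real d))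
      - log b (real (card Z) * c / real d)
    \<le> - (\<Sum>s\<in>A. \<Sum>y\<in>Y. (\<Sum>x\<in>{x \<in> C. f x = y}. joint_prob S X s x)
        * log b ((\<Sum>x\<in>{x \<in> C. f x = y}. joint_prob S X s x)
          / (\<Sum>s\<in>A. \<Sum>x\<in>{x \<in> C. f x = y}. joint_prob S X s x)))"
  proof (rule sum_entropy_ge[OF S(2) X(2) f(2,1) measure_nonneg sum_joint_prob[OF S X] b_gt_1 \<open>c > 0\<close>])
    show "f x \<in> Z" if "s \<in> A" "x \<in> C" "joint_prob S X s x > 0" for s x
      using supp'[OF that] Z(1)[OF that(1)] by blast
  qed (use U(3) Z(2,3) fibre' in auto)
  moreover have "conditional_divergence b S X (\<lambda>s. uniform_measure (count_space C) (U s)) =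
      (\<Sum>s\<in>A. \<Sum>x\<in>C. joint_prob S X s x * log b (joint_prob S X s x / prob (S -` {s} \<inter> space M) * real d))"
    using U supp b_gt_1 by (intro conditional_divergence_uniform[OF S X])
  ultimately show ?thesis
    unfolding discrete_entropy_eq_sum[OF S] discrete_cond_entropy_eq_sum[OF S Y f(2)]
      prob_eq_sum_joint[OF S(1) X] joint_prob_map[OF S(1) X, where f = f] pY by simp
qed

end

subsection \<open>Bounds on the equivocation\<close>

theorem proposition47:
  fixes K :: "'a::{field,finite} set"
    and \<D> C\<^sub>1 C\<^sub>2 :: "'a vec set"
    and G \<Delta>G G\<^sub>2 :: "'a mat"
    and \<psi> :: "'a vec \<Rightarrow> 'a vec set"
    and M :: "'w measure"
    and S X :: "'w \<Rightarrow> 'a vec"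
    and q m l n k \<mu> :: nat
    and b :: real
  assumes "subfield K (class_ring :: 'a ring)"
    and "q = card K" and "m = ext_degree K"
    and "l \<ge> 1" and "n \<ge> 1" and "l \<le> k" and "k \<le> n" and "m \<ge> l + n"
    and "MRD K (l + n) \<D>" and "code_dim (l + n) \<D> = k"
    and "systematic_generator k (l + n) G \<D>"
    and "\<Delta>G \<in> carrier_mat l n" and "G\<^sub>2 \<in> carrier_mat (k - l) n"
    and "G = four_block_mat (1\<^sub>m l) \<Delta>G (0\<^sub>m (k - l) l) G\<^sub>2"
    and "C\<^sub>1 = punctured_code n \<D>" and "C\<^sub>2 = shortened_code l n \<D>"
    and "\<psi> = coset_map \<Delta>G C\<^sub>2"
    and "prob_space M"
    and "S \<in> measurable M (count_space (carrier_vec l))"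
    and "X \<in> measurable M (count_space (carrier_vec n))"
    and "AE \<omega> in M. X \<omega> \<in> \<psi> (S \<omega>)"
    and "b = real (q ^ m)"
    and "\<mu> \<le> code_dim n C\<^sub>1"
  shows "prob_space.discrete_entropy M b S
           - prob_space.conditional_divergence M b S X (\<lambda>s. uniform_on n (\<psi> s))
           - max 0 (real \<mu> - real (code_dim n C\<^sub>2))
         \<le> prob_space.universal_equivocation M b K \<mu> n S X
       \<and> prob_space.universal_equivocation M b K \<mu> n S X
         \<le> real l - max 0 (real \<mu> - real (code_dim n C\<^sub>2))"
proof -
  have "nested_coset_scheme K \<D> \<Delta>G l n k"
  proof (rule nested_coset_scheme.intro[OF assms(1) assms(9) _ assms(10) assms(5) assms(6) assms(7) assms(12)])
    show "l + n \<le> ext_degree K" using assms(3,8) by simp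
    show "s @\<^sub>v (\<Delta>G\<^sup>T *\<^sub>v s) \<in> \<D>" if "s \<in> carrier_vec l" for s
      using encode_in_row_space[OF assms(12,13) that] assms(11,14) unfolding systematic_generator_def by simp
  qed
  then interpret nested_coset_scheme K \<D> \<Delta>G l n k .
  note C_eq = assms(15) assms(16) assms(17)[unfolded assms(16)]
  \<comment> \<open>The base is the size of the field, so logarithms of code sizes are
    dimensions.\<close>
  have b: "b = real CARD('a)"
    using card_UNIV_eq_power_ext_degree[OF K] assms(2,3,22) by simp
  interpret prob_space M by fact
  interpret information_space M b
    by unfold_locales (use order_ge_2 b in simp)
  note S = assms(19) finite_carrier_vec and X = assms(20) finite_carrier_vec
  let ?p = "joint_prob S X"
  let ?E = "{B \<in> carrier_mat \<mu> n. elements_mat B \<subseteq> K}"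
  let ?H = "\<lambda>B. discrete_cond_entropy b S (\<lambda>\<omega>. B *\<^sub>v X \<omega>)"
  have \<mu>: "\<mu> \<le> k" using assms(15,23) code_dim_C\<^sub>1 by simp
  \<comment> \<open>The positive part becomes truncated subtraction of natural numbers, the form in
    which the counting lemmas state it.\<close>
  have gap: "max 0 (real \<mu> - real (code_dim n C\<^sub>2)) = real (\<mu> - (k - l))"
    unfolding C_eq code_dim_C\<^sub>2 by (simp add: of_nat_diff max_def)
  have log_b: "log b (real (CARD('a) ^ j)) = real j" for j
    using b b_gt_1 by (simp add: log_nat_power)
  \<comment> \<open>Almost sure membership in the coset becomes exact vanishing of the joint law,
    since each single pair of values is an event.\<close>
  have supp: "?p s x = 0" if s: "s \<in> carrier_vec l" and x: "x \<in> carrier_vec n" "x \<notin> coset_map \<Delta>G (shortened_code l n \<D>) s" for s x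
  proof -
    have "AE \<omega> in M. \<omega> \<notin> S -` {s} \<inter> X -` {x} \<inter> space M"
      using assms(21) by eventually_elim (use x C_eq in auto)
    then show ?thesis using prob_eq_0[OF joint_events[OF S(1) X(1)]] by blast
  qed
  have finE: "finite ?E" by (rule finite_subset[OF _ finite_carrier_mat[of \<mu> n]]) auto
  obtain B\<^sub>0 where B\<^sub>0: "B\<^sub>0 \<in> carrier_mat \<mu> n" "elements_mat B\<^sub>0 \<subseteq> K"
    and B\<^sub>0_fibre: "\<And>y. card {x \<in> punctured_code n \<D>. B\<^sub>0 *\<^sub>v x = y} \<le> CARD('a) ^ (k - \<mu>)"
    using exists_balanced_observation[OF \<mu>] by blast
  \<comment> \<open>For the upper bound it suffices to count the values of \<open>S\<close>
    compatible with one observation of the balanced matrix.\<close>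
  have "?H B\<^sub>0 \<le> real (l - (\<mu> - (k - l)))"
  proof -
    have meas: "(\<lambda>\<omega>. B\<^sub>0 *\<^sub>v X \<omega>) \<in> measurable M (count_space (carrier_vec \<mu>))"
      using B\<^sub>0(1) by (intro measurable_compose[OF X(1)]) auto
    have "card {s \<in> carrier_vec l. joint_prob S (\<lambda>\<omega>. B\<^sub>0 *\<^sub>v X \<omega>) s y > 0} \<le> CARD('a) ^ (l - (\<mu> - (k - l)))" for y
    proof (cases "\<mu> \<le> k - l")
      case True
      have "card {s \<in> carrier_vec l. joint_prob S (\<lambda>\<omega>. B\<^sub>0 *\<^sub>v X \<omega>) s y > 0} \<le> card (carrier_vec l :: 'a vec set)"
        by (intro card_mono finite_carrier_vec) auto
      then show ?thesis using True by (simp add: card_carrier_vec)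
    next
      \<comment> \<open>Every compatible \<open>s\<close> has a witness in its coset that is mapped
        to \<open>y\<close>. Cosets are disjoint, so the witnesses are distinct points of a single
        fibre of \<open>B\<^sub>0\<close> on the punctured code.\<close>
      case False
      let ?R = "{s \<in> carrier_vec l. joint_prob S (\<lambda>\<omega>. B\<^sub>0 *\<^sub>v X \<omega>) s y > 0}"
      have "\<exists>x. x \<in> coset_map \<Delta>G (shortened_code l n \<D>) s \<and> B\<^sub>0 *\<^sub>v x = y" if s: "s \<in> ?R" for s
      proof (rule ccontr)
        assume none: "\<not> ?thesis"
        have "(\<Sum>x\<in>{x \<in> carrier_vec n. B\<^sub>0 *\<^sub>v x = y}. ?p s x) = 0"
          using none supp s by (intro sum.neutral) auto
        then show False using s joint_prob_map[OF S(1) X, where f = "(*\<^sub>v) B\<^sub>0" and s = s and y = y] by simp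
      qed
      then have "\<forall>s\<in>?R. \<exists>x. x \<in> coset_map \<Delta>G (shortened_code l n \<D>) s \<and> B\<^sub>0 *\<^sub>v x = y" by (rule ballI)
      from bchoice[OF this] obtain g where
        "\<forall>s\<in>?R. g s \<in> coset_map \<Delta>G (shortened_code l n \<D>) s \<and> B\<^sub>0 *\<^sub>v g s = y" ..
      then have g: "g s \<in> coset_map \<Delta>G (shortened_code l n \<D>) s" "B\<^sub>0 *\<^sub>v g s = y" if "s \<in> ?R" for s
        using that by (blast dest: bspec)+
      have "inj_on g ?R"
      proof (rule inj_onI)
        fix s t assume st: "s \<in> ?R" "t \<in> ?R" "g s = g t"
        show "s = t"
        proof (rule coset_map_disjoint)
          show "s \<in> carrier_vec l" "t \<in> carrier_vec l" using st by blast+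
          show "g s \<in> coset_map \<Delta>G (shortened_code l n \<D>) s" by (rule g(1)[OF st(1)])
          show "g s \<in> coset_map \<Delta>G (shortened_code l n \<D>) t" unfolding st(3) by (rule g(1)[OF st(2)])
        qed
      qed
      moreover have "g ` ?R \<subseteq> {x \<in> punctured_code n \<D>. B\<^sub>0 *\<^sub>v x = y}"
      proof (rule image_subsetI)
        fix s assume s: "s \<in> ?R"
        then have "s \<in> carrier_vec l" by blast
        then show "g s \<in> {x \<in> punctured_code n \<D>. B\<^sub>0 *\<^sub>v x = y}"
          using coset_map_subset g[OF s] by blast
      qed
      ultimately have "card ?R \<le> card {x \<in> punctured_code n \<D>. B\<^sub>0 *\<^sub>v x = y}"
        using finite_C\<^sub>1 by (intro card_inj_on_le) auto
      also have "\<dots> \<le> CARD('a) ^ (k - \<mu>)" by (rule B\<^sub>0_fibre)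
      also have "k - \<mu> = l - (\<mu> - (k - l))" using False \<mu> l_le by linarith
      finally show ?thesis .
    qed
    then have "real (card {s \<in> carrier_vec l. joint_prob S (\<lambda>\<omega>. B\<^sub>0 *\<^sub>v X \<omega>) s y > 0})
        \<le> real (CARD('a) ^ (l - (\<mu> - (k - l))))" for y
      using of_nat_mono by blast
    moreover have "real (CARD('a) ^ (l - (\<mu> - (k - l)))) > 0" using order_ge_2 by simp
    ultimately have "?H B\<^sub>0 \<le> log b (real (CARD('a) ^ (l - (\<mu> - (k - l)))))"
      by (intro discrete_cond_entropy_le[OF S meas finite_carrier_vec])
    then show ?thesis unfolding log_b .
  qed
  moreover have "universal_equivocation b K \<mu> n S X \<le> ?H B\<^sub>0"
    unfolding universal_equivocation_def using finE B\<^sub>0 by (intro Min_le) auto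
  moreover have "real (l - (\<mu> - (k - l))) = real l - real (\<mu> - (k - l))"
    using \<mu> l_le by (intro of_nat_diff) linarith
  ultimately have upper: "universal_equivocation b K \<mu> n S X \<le> real l - real (\<mu> - (k - l))" by linarith
  have "discrete_entropy b S - conditional_divergence b S X (\<lambda>s. uniform_on n (\<psi> s)) - real (\<mu> - (k - l)) \<le> ?H B"
    if B: "B \<in> ?E" for B
  proof -
    let ?C1 = "punctured_code n \<D>" and ?C2 = "shortened_code l n \<D>"
    let ?z1 = "card ((*\<^sub>v) B ` ?C1)" and ?z2 = "card ((*\<^sub>v) B ` ?C2)"
    have z2: "?z2 > 0" and z1: "?z1 > 0"
      using finite_C\<^sub>1 finite_C\<^sub>2 linear_code_zero[OF lin_C\<^sub>1] linear_code_zero[OF lin_C\<^sub>2]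
      by (auto simp: card_gt_0_iff)
    have c2: "card ?C2 > 0" using finite_C\<^sub>2 linear_code_zero[OF lin_C\<^sub>2] by (auto simp: card_gt_0_iff)
    \<comment> \<open>Here \<open>Z\<close> is the image of \<open>?C1\<close>, the coset size
      \<open>d\<close> is \<open>card ?C2\<close>, and \<open>c\<close> is the bound on fibres
      inside a coset. The argument of the logarithm is thus the ratio \<open>?z1 / ?z2\<close> of
      the two image sizes.\<close>
    have "discrete_entropy b S - conditional_divergence b S X (\<lambda>s. uniform_measure (count_space (carrier_vec n)) (coset_map \<Delta>G ?C2 s))
        - log b (real ?z1 * (real (card ?C2) / real ?z2) / real (card ?C2)) \<le> ?H B"
    proof (rule discrete_cond_entropy_ge[OF S X _ finite_carrier_vec])
      show "(*\<^sub>v) B ` carrier_vec n \<subseteq> carrier_vec \<mu>" using B by auto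
      show "coset_map \<Delta>G ?C2 s \<subseteq> carrier_vec n" if "s \<in> carrier_vec l" for s
        using coset_map_subset[OF that] C\<^sub>1_carrier by blast
      show "card (coset_map \<Delta>G ?C2 s) = card ?C2" if "s \<in> carrier_vec l" for s by (rule card_coset_map[OF that])
      show "(*\<^sub>v) B ` coset_map \<Delta>G ?C2 s \<subseteq> (*\<^sub>v) B ` ?C1" if "s \<in> carrier_vec l" for s
        using coset_map_subset[OF that] by blast
      show "finite ((*\<^sub>v) B ` ?C1)" "(*\<^sub>v) B ` ?C1 \<noteq> {}" using finite_C\<^sub>1 z1 by auto
      show "real (card ?C2) / real ?z2 > 0" using c2 z2 by simp
      show "real (card {x \<in> coset_map \<Delta>G ?C2 s. B *\<^sub>v x = y}) \<le> real (card ?C2) / real ?z2"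
        if "s \<in> carrier_vec l" for s y
      proof -
        have "card {x \<in> coset_map \<Delta>G ?C2 s. B *\<^sub>v x = y} * ?z2 \<le> card ?C2"
          using card_fibre_coset[OF _ that] B by blast
        then have "real (card {x \<in> coset_map \<Delta>G ?C2 s. B *\<^sub>v x = y}) * real ?z2 \<le> real (card ?C2)"
          by (metis of_nat_mono of_nat_mult)
        then show ?thesis using z2 by (simp add: pos_le_divide_eq)
      qed
    qed (use c2 supp in auto)
    moreover have "log b (real ?z1 * (real (card ?C2) / real ?z2) / real (card ?C2)) \<le> real (\<mu> - (k - l))"
    proof -
      have "real ?z1 \<le> real ?z2 * real (CARD('a) ^ (\<mu> - (k - l)))"
        using card_image_le_power[of B \<mu>] B by (metis (no_types, lifting) mem_Collect_eq of_nat_mono of_nat_mult)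
      then have "real ?z1 / real ?z2 \<le> real (CARD('a) ^ (\<mu> - (k - l)))"
        using z2 by (simp add: pos_divide_le_eq mult.commute)
      then have "log b (real ?z1 / real ?z2) \<le> log b (real (CARD('a) ^ (\<mu> - (k - l))))"
        using z1 z2 b_gt_1 by (intro log_mono) auto
      also have "real ?z1 / real ?z2 = real ?z1 * (real (card ?C2) / real ?z2) / real (card ?C2)"
        using c2 by simp
      finally show ?thesis unfolding log_b .
    qed
    ultimately show ?thesis unfolding uniform_on_def C_eq by linarith
  qed
  \<comment> \<open>The bound holds for every admissible \<open>B\<close>; the set of these is
    finite, and \<open>B\<^sub>0\<close> shows that it is nonempty, so the bound passes to the
    minimum.\<close>
  then have "discrete_entropy b S - conditional_divergence b S X (\<lambda>s. uniform_on n (\<psi> s)) - real (\<mu> - (k - l))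
      \<le> universal_equivocation b K \<mu> n S X"
    unfolding universal_equivocation_def using finE B\<^sub>0 by (subst Min_ge_iff) auto
  with upper show ?thesis unfolding gap by blast
qed

end
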